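(* Let $p$ be an odd prime, $r$ a positive integer, and $a\in\mathbb{Z}$ with $\gcd(p,a)=1$. (1) If $\left(\frac{a}{p}\right)=1$, then the discriminant module of the even nondegenerate lattice with Gram matrix $\begin{pmatrix}2p^r & p^r\\ p^r & \frac12\left(p^r-\left(\frac{-1}{p}\right)^r\right)\end{pmatrix}$ is isometrically isomorphic to $\underline{A}_{p^r}^a$, and no even nondegenerate lattice of smaller rank has discriminant module isometrically isomorphic to $\underline{A}_{p^r}^a$. (2) If $\left(\frac{a}{p}\right)=-1$ and $r$ is even, choose an odd prime $q\ne p$ with $\left(\frac{q}{p}\right)=-1$ and an integer $v$ with $p^rv^2\equiv1\pmod q$ and $v^2\equiv1\pmod 4$. Then the discriminant module of the even nondegenerate lattice with Gram matrix $\begin{pmatrix}2qp^r & p^rv\\ p^rv & \frac{p^rv^2-1}{2q}\end{pmatrix}$ is isometrically isomorphic to $\underline{A}_{p^r}^a$, and no even nondegenerate lattice of smaller rank has this property. (3) If $\left(\frac{a}{p}\right)=-1$, $r$ is odd and $p\equiv3\pmod4$, then the discriminant module of the even nondegenerate lattice with Gram matrix $\begin{pmatrix}-2p^r & p^r\\ p^r & -\frac12(p^r+1)\end{pmatrix}$ is isometrically isomorphic to $\underline{A}_{p^r}^a$, and no even nondegenerate lattice of smaller rank has this property. (4) If $\left(\frac{a}{p}\right)=-1$, $r$ is odd and $p\equiv1\pmod4$, then there is no even nondegenerate lattice of rank $1$ or $2$ whose discriminant module is isometrically isomorphic to $\underline{A}_{p^r}^a$. Moreover, choose an odd prime $q$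 with $q\equiv2\pmod3$ and $\left(\frac{q}{p}\right)=-1$, let $v$ be an integer with $p^rv^2\equiv-\frac{4q+1}{3}\pmod q$ and $v^2\equiv-\frac{4q+1}{3}\pmod4$, and set $x=\frac{1}{4q}\left(p^rv^2+\frac{4q+1}{3}\right)$. Then the lattice with Gram matrix $\begin{pmatrix}2qp^r & p^rv & 0 & 0\\ p^rv & 2x & 1 & 0\\ 0&1&2&1\\0&0&1&2\end{pmatrix}$ is an even nondegenerate lattice of rank $4$ whose discriminant module is isometrically isomorphic to $\underline{A}_{p^r}^a$.
   Context: $\left(\frac{\cdot}{p}\right)$ denotes the Legendre symbol. A lattice $(L,B)$ is a free $\mathbb{Z}$-module $L$ of finite rank with a symmetric bilinear form $B\colon L\times L\to\mathbb{R}$; it is nondegenerate if its Gram matrix with respect to a basis has nonzero determinant, and even if $B(x,y)\in\mathbb{Z}$ for all $x,y$ and $B(x,x)\in2\mathbb{Z}$ for all $x$. The lattice with Gram matrix $G$ (a symmetric $n\times n$ real matrix) is $\mathbb{Z}^n$ with $B(x,y)=x^{\mathrm T}Gy$. The dual lattice is $L^\sharp=\{v\in\mathbb{R}\otimes L: B(v,w)\in\mathbb{Z}\ \forall w\in L\}$, and for even nondegenerate $L$ the discriminant module is $D_L=(L^\sharp/L,\ v+L\mapsto\frac12B(v,v)+\mathbb{Z})$. A finite quadratic module is a finite abelian group $M$ with $Q\colon M\to\mathbb{Q}/\mathbb{Z}$ such that $Q(nx)=n^2Q(x)$ and $B_Q(x,y)=Q(x+y)-Q(x)-Q(y)$ is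 bilinear and nondegenerate; an isometric isomorphism is a group isomorphism preserving $Q$. For an odd prime $p$, $r\ge1$, $p\nmid a$: $\underline{A}_{p^r}^a=(\mathbb{Z}/p^r\mathbb{Z},\ x+p^r\mathbb{Z}\mapsto\frac{a}{p^r}x^2+\mathbb{Z})$. *)

theory Defs
  imports
    "HOL-Analysis.Analysis"
    "HOL-Algebra.Elementary_Groups"
    "HOL-Number_Theory.Number_Theory"
    "HOL-Combinatorics.Permutations"
begin

text \<open>
  A lattice \<open>(L, B)\<close> is given inside a real vector space: \<open>L\<close> is the set of integral linear
  combinations of finitely many vectors that are linearly independent over the reals, so that
  \<open>span L\<close> is the real extension of the free \<open>\<int>\<close>-module \<open>L\<close>. Every free \<open>\<int>\<close>-module of finite rank
  arises in this way. The form \<open>B\<close> stands for the real bilinear extension of the form on \<open>L\<close>;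
  only its values on \<open>span L\<close> matter.
\<close>

definition int_basis :: "'v::real_vector set \<Rightarrow> 'v set \<Rightarrow> bool" where
  "int_basis b L \<longleftrightarrow> finite b \<and> independent b \<and>
     L = range (\<lambda>c :: 'v \<Rightarrow> int. \<Sum>x\<in>b. real_of_int (c x) *\<^sub>R x)"

definition int_lattice :: "'v::real_vector set \<Rightarrow> ('v \<Rightarrow> 'v \<Rightarrow> real) \<Rightarrow> bool" where
  "int_lattice L B \<longleftrightarrow> (\<exists>b. int_basis b L) \<and> bilinear B \<and> (\<forall>x y. B x y = B y x)"

definition lattice_rank :: "'v::real_vector set \<Rightarrow> nat" where
  "lattice_rank L = card (SOME b. int_basis b L)"

text \<open>Leibniz formula for the determinant of the Gram matrix \<open>(B x y)\<close> with \<open>x, y\<close> ranging over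
  the basis \<open>b\<close>.\<close>

definition gram_det :: "('v \<Rightarrow> 'v \<Rightarrow> real) \<Rightarrow> 'v set \<Rightarrow> real" where
  "gram_det B b = (\<Sum>\<pi> | \<pi> permutes b. of_int (sign \<pi>) * (\<Prod>x\<in>b. B x (\<pi> x)))"

definition nondegenerate_lattice :: "'v::real_vector set \<Rightarrow> ('v \<Rightarrow> 'v \<Rightarrow> real) \<Rightarrow> bool" where
  "nondegenerate_lattice L B \<longleftrightarrow> int_lattice L B \<and> (\<exists>b. int_basis b L \<and> gram_det B b \<noteq> 0)"

definition even_lattice :: "'v::real_vector set \<Rightarrow> ('v \<Rightarrow> 'v \<Rightarrow> real) \<Rightarrow> bool" where
  "even_lattice L B \<longleftrightarrow> int_lattice L B \<and>
     (\<forall>x\<in>L. \<forall>y\<in>L. B x y \<in> \<int>) \<and> (\<forall>x\<in>L. \<exists>k::int. B x x = 2 * of_int k)"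

definition std_lattice :: "(real ^ 'n) set" where
  "std_lattice = {x. \<forall>i. x $ i \<in> \<int>}"

definition gram_form :: "real ^ 'n ^ 'n \<Rightarrow> real ^ 'n \<Rightarrow> real ^ 'n \<Rightarrow> real" where
  "gram_form G x y = x \<bullet> (G *v y)"

definition dual_lattice :: "'v::real_vector set \<Rightarrow> ('v \<Rightarrow> 'v \<Rightarrow> real) \<Rightarrow> 'v set" where
  "dual_lattice L B = {v \<in> span L. \<forall>w\<in>L. B v w \<in> \<int>}"

text \<open>Elements of \<open>\<rat>/\<int>\<close> are represented as cosets of \<open>\<int>\<close> in the reals, that is, inside \<open>\<real>/\<int>\<close>.\<close>

definition mod_int :: "real \<Rightarrow> real set" where
  "mod_int t = {t + of_int k | k :: int. True}"

record 'a quadratic_module = "'a monoid" +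
  qform :: "'a \<Rightarrow> real set"

definition isometric ::
    "('a, 'c) quadratic_module_scheme \<Rightarrow> ('b, 'd) quadratic_module_scheme \<Rightarrow> bool" where
  "isometric M N \<longleftrightarrow> (\<exists>f \<in> iso M N. \<forall>x \<in> carrier M. qform N (f x) = qform M x)"

definition additive_group :: "'v::ab_group_add set \<Rightarrow> 'v monoid" where
  "additive_group S = \<lparr>carrier = S, monoid.mult = (+), one = 0\<rparr>"

text \<open>For an even lattice the class of \<open>B v v / 2\<close> does not depend on the representative \<open>v\<close> of the
  coset \<open>X\<close>, so the union below is a union of equal sets.\<close>

definition discriminant_module ::
    "'v::real_vector set \<Rightarrow> ('v \<Rightarrow> 'v \<Rightarrow> real) \<Rightarrow> 'v set quadratic_module" where
  "discriminant_module L B =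
     monoid.extend (additive_group (dual_lattice L B) Mod L)
       (quadratic_module.fields (\<lambda>X. \<Union>v\<in>X. mod_int (B v v / 2)))"

text \<open>The module \<open>A\<close> with subscript \<open>n\<close> and superscript \<open>a\<close>.\<close>

definition cyclic_qm :: "nat \<Rightarrow> int \<Rightarrow> int quadratic_module" where
  "cyclic_qm n a =
     monoid.extend (integer_mod_group n)
       (quadratic_module.fields (\<lambda>x. mod_int (of_int a / of_nat n * of_int x ^ 2)))"

end

theory Submission
  imports Defs
begin

text \<open>
  In each of the displayed Gram matrices the first row is divisible by \<open>n = p ^ r\<close> and the
  determinant is \<open>n\<close> or \<open>- n\<close>. Solving \<open>G x = u\<close> for integral \<open>u\<close> shows that all coordinates of \<open>x\<close> except
  the first are integral, so the dual lattice is generated by the lattice and \<open>(1/n, 0, ..., 0)\<close>, and the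
  discriminant module is cyclic with form \<open>c x^2 / n\<close>, where \<open>2 c n\<close> is the upper left entry.
  Hensel lifting identifies it with the given module as soon as \<open>c\<close> and \<open>a\<close> have the same Legendre symbol.

  A rank 1 lattice generated by \<open>e\<close> is impossible because the class of \<open>e / 2\<close> would have
  order 2 in a group of odd order. In rank 2 cyclicity forces the determinant to be \<open>n\<close> or \<open>- n\<close>; being
  congruent to 3 modulo 4 it equals \<open>- n\<close> if \<open>p\<close> is 1 modulo 4. Then \<open>- a\<close> is, up to squares, represented
  modulo \<open>p\<close> by an integral binary form of discriminant \<open>p ^ r\<close>, and for odd \<open>r\<close> quadratic reciprocity
  shows that all represented values prime to \<open>p\<close> are squares modulo \<open>p\<close>.
\<close>

section \<open>Even lattices with cyclic discriminant module\<close>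

lemma int_basis_0: "int_basis b L \<Longrightarrow> 0 \<in> L"
  unfolding int_basis_def by (auto intro!: image_eqI[where x = "\<lambda>_. 0"])

lemma int_basis_add:
  assumes "int_basis b L" "x \<in> L" "y \<in> L" shows "x + y \<in> L"
proof -
  from assms obtain c d :: "'a \<Rightarrow> int" where
    "x = (\<Sum>z\<in>b. real_of_int (c z) *\<^sub>R z)" "y = (\<Sum>z\<in>b. real_of_int (d z) *\<^sub>R z)"
    unfolding int_basis_def by auto
  then have "x + y = (\<Sum>z\<in>b. real_of_int (c z + d z) *\<^sub>R z)"
    by (simp add: sum.distrib scaleR_add_left)
  then show ?thesis using assms(1) unfolding int_basis_def
    by (auto intro!: image_eqI[where x = "\<lambda>z. c z + d z"])
qed

lemma int_basis_uminus:
  assumes "int_basis b L" "x \<in> L" shows "- x \<in> L"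
proof -
  from assms obtain c :: "'a \<Rightarrow> int" where
    "x = (\<Sum>z\<in>b. real_of_int (c z) *\<^sub>R z)"
    unfolding int_basis_def by auto
  then have "- x = (\<Sum>z\<in>b. real_of_int (- c z) *\<^sub>R z)"
    by (simp add: sum_negf)
  then show ?thesis using assms(1) unfolding int_basis_def
    by (auto intro!: image_eqI[where x = "\<lambda>z. - c z"])
qed

lemma int_basis_diff:
  assumes "int_basis b L" "x \<in> L" "y \<in> L" shows "x - y \<in> L"
  using int_basis_add[OF assms(1,2) int_basis_uminus[OF assms(1,3)]] by simp

lemma int_basis_subset:
  assumes "int_basis b L" shows "b \<subseteq> L"
proof
  fix z assume z: "z \<in> b"
  have "z = (\<Sum>x\<in>b. real_of_int (if x = z then 1 else 0) *\<^sub>R x)"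
    using assms z unfolding int_basis_def by (simp add: if_distrib [of real_of_int]
        if_distrib [of "\<lambda>t. t *\<^sub>R _"] cong: if_cong)
  then show "z \<in> L" using assms unfolding int_basis_def
    by (auto intro!: image_eqI[where x = "\<lambda>x. if x = z then 1 else 0"])
qed

lemma int_basis_span:
  assumes "int_basis b L" shows "span L = span b"
proof
  have "L \<subseteq> span b"
    using assms unfolding int_basis_def by (auto intro: span_sum span_scale span_base)
  then show "span L \<subseteq> span b" by (simp add: span_minimal subspace_span)
  show "span b \<subseteq> span L" by (rule span_mono[OF int_basis_subset[OF assms]])
qed

text \<open>\<open>lattice_rank\<close> picks a basis by choice. Every integral basis is independent
  over the reals and spans \<open>span L\<close>, so its cardinality is the real dimension of
  \<open>span L\<close>, whichever basis was picked.\<close>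

lemma lattice_rank_eq:
  assumes "int_basis b L" shows "lattice_rank L = card b"
proof -
  have "int_basis (SOME b. int_basis b L) L" using assms by (rule someI)
  then have "card (SOME b. int_basis b L) = dim (span L)"
    by (metis int_basis_span int_basis_def dim_span_eq_card_independent)
  also have "\<dots> = card b"
    by (metis assms int_basis_span int_basis_def dim_span_eq_card_independent)
  finally show ?thesis unfolding lattice_rank_def .
qed

lemma mod_int_eq_iff: "mod_int s = mod_int t \<longleftrightarrow> s - t \<in> \<int>"
proof
  assume "mod_int s = mod_int t"
  moreover have "s \<in> mod_int s" unfolding mod_int_def by (auto intro: exI[of _ 0])
  ultimately obtain k :: int where "s = t + of_int k" unfolding mod_int_def by auto
  then show "s - t \<in> \<int>" by simp
next
  assume "s - t \<in> \<int>"
  then obtain k :: int where k: "s = t + of_int k" by (metis Ints_cases add.commute diff_add_cancel)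
  show "mod_int s = mod_int t"
  proof (intro Set.set_eqI iffI)
    fix z assume "z \<in> mod_int s"
    then obtain j :: int where "z = s + of_int j" unfolding mod_int_def by auto
    then have "z = t + of_int (k + j)" using k by simp
    then show "z \<in> mod_int t" unfolding mod_int_def by blast
  next
    fix z assume "z \<in> mod_int t"
    then obtain j :: int where "z = t + of_int j" unfolding mod_int_def by auto
    then have "z = s + of_int (j - k)" using k by simp
    then show "z \<in> mod_int s" unfolding mod_int_def by blast
  qed
qed

section \<open>The discriminant module of an even lattice in terms of representatives\<close>

context
  fixes L :: "'v::real_vector set" and B :: "'v \<Rightarrow> 'v \<Rightarrow> real"
  assumes even: "even_lattice L B"
begin

lemma even_lattice_basis: obtains b where "int_basis b L"
  using even unfolding even_lattice_def int_lattice_def by auto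

lemma even_lattice_bilinear: "bilinear B" and even_lattice_sym: "B x y = B y x"
  using even unfolding even_lattice_def int_lattice_def by auto

lemma even_lattice_closed:
  "0 \<in> L" "x \<in> L \<Longrightarrow> y \<in> L \<Longrightarrow> x + y \<in> L" "x \<in> L \<Longrightarrow> y \<in> L \<Longrightarrow> x - y \<in> L" "x \<in> L \<Longrightarrow> - x \<in> L"
  by (metis even_lattice_basis int_basis_0 int_basis_add int_basis_diff int_basis_uminus)+

lemma even_lattice_subset_dual: "x \<in> L \<Longrightarrow> x \<in> dual_lattice L B"
  using even unfolding even_lattice_def dual_lattice_def by (auto intro: span_base)

lemma dual_lattice_add:
  "x \<in> dual_lattice L B \<Longrightarrow> y \<in> dual_lattice L B \<Longrightarrow> x + y \<in> dual_lattice L B"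
  unfolding dual_lattice_def
  by (auto simp: bilinear_ladd[OF even_lattice_bilinear] intro: span_add)

lemma dual_lattice_diff:
  "x \<in> dual_lattice L B \<Longrightarrow> y \<in> dual_lattice L B \<Longrightarrow> x - y \<in> dual_lattice L B"
  unfolding dual_lattice_def
  by (auto simp: bilinear_lsub[OF even_lattice_bilinear] intro: span_diff)

lemma dual_lattice_scale:
  "x \<in> dual_lattice L B \<Longrightarrow> real_of_int m *\<^sub>R x \<in> dual_lattice L B"
  unfolding dual_lattice_def
  by (auto simp: bilinear_lmul[OF even_lattice_bilinear] intro: span_scale)

text \<open>The difference is \<open>B h h / 2 + B x h\<close>; evenness makes the first term
  integral, duality the second. This is why the quadratic form is well defined on cosets.\<close>

lemma half_norm_mod_lattice:
  assumes x: "x \<in> dual_lattice L B" and h: "h \<in> L"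
  shows "B (h + x) (h + x) / 2 - B x x / 2 \<in> \<int>"
proof -
  obtain k :: int where k: "B h h = 2 * of_int k" using even h unfolding even_lattice_def by auto
  have "B x h \<in> \<int>" using x h unfolding dual_lattice_def by auto
  moreover have "B (h + x) (h + x) / 2 - B x x / 2 = of_int k + B x h"
    using k even_lattice_sym[of x h]
    by (simp add: bilinear_ladd[OF even_lattice_bilinear] bilinear_radd[OF even_lattice_bilinear]
        field_simps)
  ultimately show ?thesis by simp
qed

text \<open>This is the shape to which \<open>r_coset_def\<close> unfolds for the additive group, so
  the carrier of the quotient can be rewritten directly in terms of it.\<close>

abbreviation (input) lattice_coset :: "'v \<Rightarrow> 'v set" where
  "lattice_coset x \<equiv> (\<Union>h\<in>L. {h + x})"

lemma lattice_coset_eq_iff: "lattice_coset x = lattice_coset y \<longleftrightarrow> x - y \<in> L"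
proof
  assume "lattice_coset x = lattice_coset y"
  moreover have "x \<in> lattice_coset x" using even_lattice_closed(1) by force
  ultimately obtain h where "h \<in> L" "x = h + y" by auto
  then show "x - y \<in> L" by simp
next
  assume d: "x - y \<in> L"
  show "lattice_coset x = lattice_coset y"
  proof (intro Set.set_eqI iffI)
    fix z assume "z \<in> lattice_coset x"
    then obtain h where "h \<in> L" "z = h + x" by auto
    then have "z = (h + (x - y)) + y" "h + (x - y) \<in> L"
      using even_lattice_closed(2) d by auto
    then show "z \<in> lattice_coset y" by blast
  next
    fix z assume "z \<in> lattice_coset y"
    then obtain h where "h \<in> L" "z = h + y" by auto
    then have "z = (h - (x - y)) + x" "h - (x - y) \<in> L"
      using even_lattice_closed(3) d by auto
    then show "z \<in> lattice_coset x" by blast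
  qed
qed

lemma carrier_discriminant_module:
  "carrier (discriminant_module L B) = lattice_coset ` dual_lattice L B"
  unfolding discriminant_module_def additive_group_def
  by (auto simp: monoid.defs FactGroup_def RCOSETS_def r_coset_def)

lemma mult_discriminant_module:
  "monoid.mult (discriminant_module L B) (lattice_coset x) (lattice_coset y)
    = lattice_coset (x + y)"
proof -
  have "(\<Union>h\<in>lattice_coset x. \<Union>k\<in>lattice_coset y. {h + k}) = lattice_coset (x + y)"
  proof (intro Set.set_eqI iffI)
    fix z assume "z \<in> (\<Union>h\<in>lattice_coset x. \<Union>k\<in>lattice_coset y. {h + k})"
    then obtain h k where "h \<in> L" "k \<in> L" "z = (h + x) + (k + y)" by auto
    then have "z = (h + k) + (x + y)" "h + k \<in> L" using even_lattice_closed(2) by auto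
    then show "z \<in> lattice_coset (x + y)" by blast
  next
    fix z assume "z \<in> lattice_coset (x + y)"
    then obtain h where "h \<in> L" "z = (h + x) + (0 + y)" by (auto simp: add.assoc)
    then show "z \<in> (\<Union>h\<in>lattice_coset x. \<Union>k\<in>lattice_coset y. {h + k})"
      using even_lattice_closed(1) by blast
  qed
  then show ?thesis
    unfolding discriminant_module_def additive_group_def
    by (simp add: monoid.defs FactGroup_def set_mult_def)
qed

lemma qform_discriminant_module:
  assumes "x \<in> dual_lattice L B"
  shows "qform (discriminant_module L B) (lattice_coset x) = mod_int (B x x / 2)"
proof -
  have "mod_int (B v v / 2) = mod_int (B x x / 2)" if "v \<in> lattice_coset x" for v
    using that half_norm_mod_lattice[OF assms] by (auto simp: mod_int_eq_iff)
  moreover have "x \<in> lattice_coset x" using even_lattice_closed(1) by force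
  ultimately have "(\<Union>v\<in>lattice_coset x. mod_int (B v v / 2)) = mod_int (B x x / 2)"
    by blast
  then show ?thesis
    unfolding discriminant_module_def by (simp add: monoid.defs quadratic_module.defs)
qed

section \<open>Isometries onto a cyclic module as integer-valued maps on the dual lattice\<close>

text \<open>Here \<phi> is the isometry composed with the projection from dual vectors to cosets.
  Later arguments can then compute with vectors and congruences modulo \<open>n\<close> and never
  return to the quotient group.\<close>

lemma isometric_cyclic_imp:
  assumes n: "n > 0" and iso: "isometric (discriminant_module L B) (cyclic_qm n a)"
  obtains \<phi> :: "'v \<Rightarrow> int" where
    "\<And>x y. x \<in> dual_lattice L B \<Longrightarrow> y \<in> dual_lattice L B \<Longrightarrow> [\<phi> (x + y) = \<phi> x + \<phi> y] (mod int n)"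
    "\<And>x. x \<in> dual_lattice L B \<Longrightarrow> [\<phi> x = 0] (mod int n) \<longleftrightarrow> x \<in> L"
    "\<exists>x\<in>dual_lattice L B. [\<phi> x = 1] (mod int n)"
    "\<And>x. x \<in> dual_lattice L B \<Longrightarrow> B x x / 2 - of_int a / of_nat n * of_int (\<phi> x) ^ 2 \<in> \<int>"
proof -
  let ?D = "discriminant_module L B" and ?D' = "dual_lattice L B"
  obtain f where f: "f \<in> iso ?D (cyclic_qm n a)"
    and fq: "\<And>X. X \<in> carrier ?D \<Longrightarrow> qform (cyclic_qm n a) (f X) = qform ?D X"
    using iso unfolding isometric_def by auto
  have carC: "carrier (cyclic_qm n a) = {0..<int n}"
    using n unfolding cyclic_qm_def by (simp add: monoid.defs carrier_integer_mod_group)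
  have multC: "monoid.mult (cyclic_qm n a) x y = (x + y) mod int n" for x y
    using n unfolding cyclic_qm_def by (simp add: monoid.defs)
  have bij: "bij_betw f (carrier ?D) {0..<int n}" and hom: "f \<in> hom ?D (cyclic_qm n a)"
    using f carC unfolding iso_def by auto
  define \<phi> where "\<phi> = (\<lambda>x. f (lattice_coset x))"
  have mem: "lattice_coset x \<in> carrier ?D" if "x \<in> ?D'" for x
    using that by (simp add: carrier_discriminant_module)
  have add: "\<phi> (x + y) = (\<phi> x + \<phi> y) mod int n" if "x \<in> ?D'" "y \<in> ?D'" for x y
    using hom_mult[OF hom mem[OF that(1)] mem[OF that(2)]]
    by (simp add: \<phi>_def multC mult_discriminant_module)
  have ran: "\<phi> x \<in> {0..<int n}" if "x \<in> ?D'" for x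
    using bij mem[OF that] unfolding \<phi>_def bij_betw_def by blast
  have 0: "0 \<in> ?D'" using even_lattice_subset_dual even_lattice_closed(1) by blast
  have "[0 + \<phi> 0 = \<phi> 0 + \<phi> 0] (mod int n)" using add[OF 0 0] unfolding cong_def
    by (metis add.right_neutral add.commute mod_mod_trivial)
  then have "[\<phi> 0 = 0] (mod int n)" by (metis cong_add_rcancel cong_sym)
  then have phi0: "\<phi> 0 = 0" using ran[OF 0] by (simp add: cong_def)
  have inj: "x - y \<in> L" if "x \<in> ?D'" "y \<in> ?D'" "\<phi> x = \<phi> y" for x y
    using bij mem[OF that(1)] mem[OF that(2)] that(3) lattice_coset_eq_iff[of x y]
    unfolding \<phi>_def bij_betw_def inj_on_def by blast
  show ?thesis
  proof
    show "[\<phi> (x + y) = \<phi> x + \<phi> y] (mod int n)" if "x \<in> ?D'" "y \<in> ?D'" for x y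
      using add[OF that] by (simp add: cong_def)
    show "[\<phi> x = 0] (mod int n) \<longleftrightarrow> x \<in> L" if x: "x \<in> ?D'" for x
    proof
      assume "[\<phi> x = 0] (mod int n)"
      then have "\<phi> x = \<phi> 0" using ran[OF x] phi0 by (simp add: cong_def)
      then show "x \<in> L" using inj[OF x 0] by simp
    next
      assume "x \<in> L"
      then have "\<phi> x = \<phi> 0" using lattice_coset_eq_iff[of x 0] unfolding \<phi>_def by simp
      then show "[\<phi> x = 0] (mod int n)" using phi0 by simp
    qed
    have "1 mod int n \<in> f ` carrier ?D" using bij n unfolding bij_betw_def by simp
    then obtain x where "x \<in> ?D'" "\<phi> x = 1 mod int n"
      unfolding carrier_discriminant_module \<phi>_def by auto
    then show "\<exists>x\<in>?D'. [\<phi> x = 1] (mod int n)"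
      by (intro bexI[of _ x]) (simp_all add: cong_def)
    show "B x x / 2 - of_int a / of_nat n * of_int (\<phi> x) ^ 2 \<in> \<int>" if x: "x \<in> ?D'" for x
    proof -
      have "mod_int (of_int a / of_nat n * of_int (\<phi> x) ^ 2) = mod_int (B x x / 2)"
        using fq[OF mem[OF x]] qform_discriminant_module[OF x] unfolding \<phi>_def
        by (simp add: cyclic_qm_def monoid.defs quadratic_module.defs)
      then show ?thesis by (simp add: mod_int_eq_iff[symmetric])
    qed
  qed
qed

lemma additive_cong_scale:
  fixes \<phi> :: "'v \<Rightarrow> int"
  assumes add: "\<And>x y. x \<in> dual_lattice L B \<Longrightarrow> y \<in> dual_lattice L B \<Longrightarrow>
      [\<phi> (x + y) = \<phi> x + \<phi> y] (mod n)"
    and x: "x \<in> dual_lattice L B"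
  shows "[\<phi> (real m *\<^sub>R x) = int m * \<phi> x] (mod n)"
proof (induction m)
  case 0
  have 0: "0 \<in> dual_lattice L B" using even_lattice_subset_dual even_lattice_closed(1) by blast
  have "[0 + \<phi> 0 = \<phi> 0 + \<phi> 0] (mod n)" using add[OF 0 0] by simp
  then have "[0 = \<phi> 0] (mod n)" by (simp only: cong_add_rcancel)
  then show ?case by (simp add: cong_sym)
next
  case (Suc m)
  have "real m *\<^sub>R x \<in> dual_lattice L B" using dual_lattice_scale[OF x, of "int m"] by simp
  then have "[\<phi> (real m *\<^sub>R x + x) = \<phi> (real m *\<^sub>R x) + \<phi> x] (mod n)" using add x by blast
  also have "[\<phi> (real m *\<^sub>R x) + \<phi> x = int m * \<phi> x + \<phi> x] (mod n)"
    by (rule cong_add[OF Suc cong_refl])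
  finally show ?case by (simp add: algebra_simps)
qed

text \<open>This is the converse of \<open>isometric_cyclic_imp\<close>. Additivity and the kernel
  \<open>L\<close> make \<phi> descend to an injective homomorphism; the multiples of a vector of
  value 1 reach every residue, which gives surjectivity.\<close>

lemma isometric_cyclicI:
  fixes \<phi> :: "'v \<Rightarrow> int"
  assumes n: "n > 0"
    and add: "\<And>x y. x \<in> dual_lattice L B \<Longrightarrow> y \<in> dual_lattice L B \<Longrightarrow>
      [\<phi> (x + y) = \<phi> x + \<phi> y] (mod int n)"
    and ker: "\<And>x. x \<in> dual_lattice L B \<Longrightarrow> [\<phi> x = 0] (mod int n) \<longleftrightarrow> x \<in> L"
    and one: "\<exists>x\<in>dual_lattice L B. [\<phi> x = 1] (mod int n)"
    and Q: "\<And>x. x \<in> dual_lattice L B \<Longrightarrow>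
      B x x / 2 - of_int a / of_nat n * of_int (\<phi> x) ^ 2 \<in> \<int>"
  shows "isometric (discriminant_module L B) (cyclic_qm n a)"
proof -
  let ?D = "discriminant_module L B" and ?D' = "dual_lattice L B"
  have carC: "carrier (cyclic_qm n a) = {0..<int n}"
    using n unfolding cyclic_qm_def by (simp add: monoid.defs carrier_integer_mod_group)
  have multC: "monoid.mult (cyclic_qm n a) x y = (x + y) mod int n" for x y
    using n unfolding cyclic_qm_def by (simp add: monoid.defs)
  have eq_iff: "[\<phi> x = \<phi> y] (mod int n) \<longleftrightarrow> x - y \<in> L" if "x \<in> ?D'" "y \<in> ?D'" for x y
  proof -
    have xy: "x - y \<in> ?D'" using dual_lattice_diff that by blast
    have "[\<phi> x = \<phi> (x - y) + \<phi> y] (mod int n)" using add[OF xy that(2)] by simp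
    then have "[\<phi> x = \<phi> y] (mod int n) \<longleftrightarrow> [\<phi> (x - y) + \<phi> y = 0 + \<phi> y] (mod int n)"
      by (auto simp: cong_def)
    also have "\<dots> \<longleftrightarrow> [\<phi> (x - y) = 0] (mod int n)" by (rule cong_add_rcancel)
    finally show ?thesis using ker[OF xy] by simp
  qed
  \<comment> \<open>\<open>f\<close> uses a chosen representative of the coset; by
    \<open>eq_iff\<close> the residue does not depend on the choice. The carrier of the target is
    \<open>{0..<int n}\<close>, hence the reduction modulo \<open>n\<close>.\<close>
  define f where "f X = \<phi> (SOME x. x \<in> ?D' \<and> X = lattice_coset x) mod int n" for X
  have f: "f (lattice_coset x) = \<phi> x mod int n" if x: "x \<in> ?D'" for x
  proof -
    let ?y = "SOME y. y \<in> ?D' \<and> lattice_coset x = lattice_coset y"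
    have "?y \<in> ?D' \<and> lattice_coset x = lattice_coset ?y"
      by (rule someI[of _ x]) (use x in simp)
    then have "[\<phi> x = \<phi> ?y] (mod int n)" using eq_iff[OF x] lattice_coset_eq_iff by blast
    then show ?thesis unfolding f_def by (simp add: cong_def)
  qed
  have hom: "f \<in> hom ?D (cyclic_qm n a)"
  proof (rule homI)
    fix X assume "X \<in> carrier ?D"
    then show "f X \<in> carrier (cyclic_qm n a)" using n unfolding carC f_def by simp
  next
    fix X Y assume "X \<in> carrier ?D" "Y \<in> carrier ?D"
    then obtain x y where xy: "x \<in> ?D'" "y \<in> ?D'" "X = lattice_coset x" "Y = lattice_coset y"
      unfolding carrier_discriminant_module by blast
    have "\<phi> (x + y) mod int n = (\<phi> x mod int n + \<phi> y mod int n) mod int n"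
      using add[OF xy(1,2)] by (simp add: cong_def mod_simps)
    then show "f (X \<otimes>\<^bsub>?D\<^esub> Y) = f X \<otimes>\<^bsub>cyclic_qm n a\<^esub> f Y"
      unfolding xy multC mult_discriminant_module
      using f[OF xy(1)] f[OF xy(2)] f[OF dual_lattice_add[OF xy(1,2)]] by simp
  qed
  have inj: "inj_on f (carrier ?D)"
  proof (rule inj_onI)
    fix X Y assume "X \<in> carrier ?D" "Y \<in> carrier ?D" "f X = f Y"
    then obtain x y where xy: "x \<in> ?D'" "y \<in> ?D'" "X = lattice_coset x" "Y = lattice_coset y"
      unfolding carrier_discriminant_module by blast
    have "[\<phi> x = \<phi> y] (mod int n)"
      using \<open>f X = f Y\<close> f[OF xy(1)] f[OF xy(2)] unfolding xy by (simp add: cong_def)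
    then show "X = Y" unfolding xy using eq_iff[OF xy(1,2)] lattice_coset_eq_iff by blast
  qed
  obtain x1 where x1: "x1 \<in> ?D'" "[\<phi> x1 = 1] (mod int n)" using one by blast
  have mult: "[\<phi> (real_of_int (int m) *\<^sub>R x1) = int m] (mod int n)" for m :: nat
    using cong_trans[OF additive_cong_scale[OF add x1(1)] cong_scalar_left[OF x1(2), of "int m"]]
    by simp
  have "f ` carrier ?D = {0..<int n}"
  proof (intro equalityI subsetI)
    fix z assume "z \<in> f ` carrier ?D"
    then show "z \<in> {0..<int n}" using n unfolding f_def by auto
  next
    fix z assume z: "z \<in> {0..<int n}"
    have D: "real_of_int (int (nat z)) *\<^sub>R x1 \<in> ?D'" by (rule dual_lattice_scale[OF x1(1)])
    have "f (lattice_coset (real_of_int (int (nat z)) *\<^sub>R x1)) = z"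
      unfolding f[OF D] using mult[of "nat z"] z by (simp add: cong_def)
    from this[symmetric] show "z \<in> f ` carrier ?D"
      unfolding carrier_discriminant_module by (rule image_eqI) (rule imageI[OF D])
  qed
  then have "f \<in> iso ?D (cyclic_qm n a)"
    using hom inj unfolding iso_def bij_betw_def carC by auto
  moreover have "qform (cyclic_qm n a) (f X) = qform ?D X" if X: "X \<in> carrier ?D" for X
  proof -
    obtain x where x: "x \<in> ?D'" "X = lattice_coset x"
      using X unfolding carrier_discriminant_module by blast
    \<comment> \<open>Replacing \<open>\<phi> x\<close> by its residue changes
      \<open>a / n * (\<phi> x)^2\<close> by an integer, so the hypothesis \<open>Q\<close> carries
      over to \<open>f\<close>.\<close>
    obtain k where k: "\<phi> x = \<phi> x mod int n + int n * k"
      by (metis mod_mult_div_eq)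
    have "real_of_int (\<phi> x) ^ 2 = of_int (\<phi> x mod int n + int n * k) ^ 2" using k by simp
    then have "real_of_int a / real n * real_of_int (\<phi> x) ^ 2
      = real_of_int a / real n * of_int (\<phi> x mod int n) ^ 2
        + of_int (a * (2 * (\<phi> x mod int n) * k + int n * k ^ 2))"
      using n by (simp add: field_simps power2_eq_square)
    then have "real_of_int a / real n * of_int (\<phi> x mod int n) ^ 2 - B x x / 2
      = - (B x x / 2 - real_of_int a / real n * real_of_int (\<phi> x) ^ 2)
        - of_int (a * (2 * (\<phi> x mod int n) * k + int n * k ^ 2))"
      by simp
    also have "\<dots> \<in> \<int>" by (rule Ints_diff[OF Ints_minus[OF Q[OF x(1)]] Ints_of_int])
    finally have "mod_int (real_of_int a / real n * of_int (\<phi> x mod int n) ^ 2) = mod_int (B x x / 2)"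
      by (simp only: mod_int_eq_iff)
    then show ?thesis
      unfolding x(2) qform_discriminant_module[OF x(1)] f[OF x(1)]
      by (simp add: cyclic_qm_def monoid.defs quadratic_module.defs)
  qed
  ultimately show ?thesis unfolding isometric_def by blast
qed

end

section \<open>Legendre symbols\<close>

text \<open>Hensel's lemma for \<open>a * s^2 - c\<close>: the derivative \<open>2 * a * s\<close>
  is a unit modulo \<open>p\<close>, because \<open>p\<close> is odd and does not divide
  \<open>c\<close>. The exponent \<open>Suc k\<close> makes the base case the given congruence
  modulo \<open>p\<close>.\<close>

lemma cong_square_multiple_lift:
  fixes a c :: int
  assumes p: "prime p" "odd p" and pc: "\<not> int p dvd c" and s: "[a * s ^ 2 = c] (mod int p)"
  shows "\<exists>s. [a * s ^ 2 = c] (mod int p ^ Suc k)"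
proof (induction k)
  case 0
  then show ?case using s by auto
next
  case (Suc k)
  then obtain s where s: "[a * s ^ 2 = c] (mod int p ^ Suc k)" by blast
  then obtain m where m: "a * s ^ 2 = c + int p ^ Suc k * m"
    using cong_sym[OF s] unfolding cong_iff_lin by blast
  have "\<not> int p dvd a * s ^ 2"
    unfolding m using pc by (simp add: dvd_add_left_iff)
  then have "\<not> int p dvd a" "\<not> int p dvd s"
    using dvd_mult2[of "int p" s s] by (auto simp: power2_eq_square)
  moreover have "\<not> int p dvd 2"
  proof
    assume "int p dvd 2"
    then have "int p \<le> 2" by (rule zdvd_imp_le) simp
    then show False using p prime_ge_2_nat[of p] by auto
  qed
  ultimately have "\<not> int p dvd 2 * a * s"
    using p by (simp add: prime_dvd_mult_iff)
  then have "coprime (2 * a * s) (int p)"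
    using p prime_imp_coprime[of "int p" "2 * a * s"] by (simp add: ac_simps)
  then obtain z where "[2 * a * s * z = 1] (mod int p)"
    using cong_solve_coprime_int by blast
  then have "[2 * a * s * z * (- m) = 1 * (- m)] (mod int p)" by (rule cong_scalar_right)
  \<comment> \<open>The Newton correction: replacing \<open>s\<close> by
    \<open>s + p ^ Suc k * y\<close> changes the error \<open>p ^ Suc k * m\<close> to first order
    by \<open>p ^ Suc k * 2 * a * s * y\<close>, so \<open>y\<close> is chosen to cancel
    \<open>m\<close> modulo \<open>p\<close>.\<close>
  then obtain y where "[2 * a * s * y = - m] (mod int p)"
    using that[of "z * (- m)"] by (simp add: mult.assoc)
  then have "int p dvd m + 2 * a * s * y"
    by (simp add: cong_iff_dvd_diff add.commute)
  then obtain t where t: "m + 2 * a * s * y = int p * t" by (elim dvdE)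
  have "a * (s + int p ^ Suc k * y) ^ 2
    = c + int p ^ Suc k * (m + 2 * a * s * y) + int p ^ Suc k * int p ^ Suc k * a * y ^ 2"
    using m by (simp add: power2_eq_square algebra_simps)
  also have "\<dots> = c + int p ^ Suc (Suc k) * (t + int p ^ k * a * y ^ 2)"
    unfolding t by (simp add: algebra_simps)
  finally have "[a * (s + int p ^ Suc k * y) ^ 2 = c] (mod int p ^ Suc (Suc k))"
    by (simp add: cong_iff_dvd_diff)
  then show ?case by blast
qed

lemma Legendre_cases:
  assumes "\<not> int p dvd a" shows "Legendre a (int p) = 1 \<or> Legendre a (int p) = - 1"
  using assms unfolding Legendre_def by (auto simp: cong_0_iff)

text \<open>By Euler's criterion both sides are congruent modulo \<open>p\<close>. Their values lie
  in {-1, 0, 1}, so they differ by at most 2, which is less than \<open>p\<close>.\<close>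

lemma Legendre_mult:
  assumes "prime p" "odd p"
  shows "Legendre (a * b) (int p) = Legendre a (int p) * Legendre b (int p)"
proof -
  have p: "2 < p" using assms prime_ge_2_nat[of p] by (cases "p = 2") auto
  have "[Legendre (a * b) (int p) = (a * b) ^ ((p - 1) div 2)] (mod int p)"
    using euler_criterion[OF assms(1) p] by simp
  also have "(a * b) ^ ((p - 1) div 2) = a ^ ((p - 1) div 2) * b ^ ((p - 1) div 2)"
    by (rule power_mult_distrib)
  also have "[\<dots> = Legendre a (int p) * Legendre b (int p)] (mod int p)"
    using euler_criterion[OF assms(1) p] by (intro cong_mult) (auto intro: cong_sym)
  finally have "int p dvd Legendre (a * b) (int p) - Legendre a (int p) * Legendre b (int p)"
    by (simp add: cong_iff_dvd_diff)
  moreover have "\<bar>Legendre (a * b) (int p) - Legendre a (int p) * Legendre b (int p)\<bar> \<le> 2"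
    unfolding Legendre_def by auto
  ultimately show ?thesis
    using p dvd_imp_le_int[of "Legendre (a * b) (int p) - Legendre a (int p) * Legendre b (int p)"
        "int p"] by linarith
qed

lemma Legendre_cong:
  assumes "[a = b] (mod p)" shows "Legendre a p = Legendre b p"
proof -
  have "[x = a] (mod p) \<longleftrightarrow> [x = b] (mod p)" for x using assms by (simp add: cong_def)
  moreover have "[a = 0] (mod p) \<longleftrightarrow> [b = 0] (mod p)" using assms by (simp add: cong_def)
  ultimately show ?thesis unfolding Legendre_def QuadRes_def by simp
qed

lemma Legendre_square:
  assumes "\<not> int p dvd a" "prime p" shows "Legendre (a ^ 2) (int p) = 1"
  using assms unfolding Legendre_def QuadRes_def
  by (auto simp: cong_0_iff prime_dvd_power_iff intro: exI[of _ a])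

lemma Legendre_minus_1:
  assumes "prime p" "odd p"
  shows "Legendre (- 1) (int p) = (if [p = 1] (mod 4) then 1 else - 1)"
proof -
  have p: "2 < p" using assms prime_ge_2_nat[of p] by (cases "p = 2") auto
  have "[Legendre (- 1) (int p) = (- 1) ^ ((p - 1) div 2)] (mod int p)"
    using euler_criterion[OF assms(1) p] by simp
  then have "int p dvd Legendre (- 1) (int p) - (- 1) ^ ((p - 1) div 2)"
    by (simp add: cong_iff_dvd_diff)
  moreover have "\<bar>Legendre (- 1) (int p) - (- 1) ^ ((p - 1) div 2)\<bar> \<le> 2"
    unfolding Legendre_def by (cases "even ((p - 1) div 2)") auto
  ultimately have "Legendre (- 1) (int p) = (- 1) ^ ((p - 1) div 2)"
    using p dvd_imp_le_int[of "Legendre (- 1) (int p) - (- 1) ^ ((p - 1) div 2)" "int p"]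
    by linarith
  moreover have "even ((p - 1) div 2) \<longleftrightarrow> [p = 1] (mod 4)"
    unfolding cong_def using assms(2) p by presburger
  ultimately show ?thesis by simp
qed

text \<open>Since \<open>a * c\<close> is a square \<open>t^2\<close> modulo \<open>p\<close>, the
  number \<open>b * t\<close> with \<open>b\<close> inverse to \<open>a\<close> solves the
  congruence modulo \<open>p\<close>, and the solution lifts. Multiplication by the unit
  \<open>s\<close> then carries the form \<open>c * x^2 / p^r\<close> to
  \<open>a * x^2 / p^r\<close>.\<close>

lemma same_Legendre_imp_square_multiple:
  fixes a c :: int
  assumes p: "prime p" "odd p" and r: "r > 0" and a: "\<not> int p dvd a"
    and eq: "Legendre c (int p) = Legendre a (int p)"
  obtains s where "[a * s ^ 2 = c] (mod int p ^ r)" "coprime s (int p ^ r)"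
proof -
  have c: "\<not> int p dvd c"
    using eq Legendre_cases[OF a] unfolding Legendre_def by (auto simp: cong_0_iff split: if_splits)
  have "Legendre (a * c) (int p) = 1"
    using Legendre_mult[OF p, of a c] eq Legendre_cases[OF a] by auto
  then obtain t where t: "[t ^ 2 = a * c] (mod int p)"
    unfolding Legendre_def QuadRes_def by (auto split: if_splits)
  have "coprime a (int p)" using a p prime_imp_coprime[of "int p" a] by (simp add: ac_simps)
  then obtain b where b: "[a * b = 1] (mod int p)" using cong_solve_coprime_int by blast
  have "[a * (b * t) ^ 2 = (a * b) * b * t ^ 2] (mod int p)"
    by (simp add: power2_eq_square algebra_simps)
  also have "[(a * b) * b * t ^ 2 = 1 * b * (a * c)] (mod int p)"
    by (intro cong_mult b t cong_refl)
  also have "1 * b * (a * c) = (a * b) * c" by simp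
  also have "[(a * b) * c = 1 * c] (mod int p)" by (intro cong_mult b cong_refl)
  finally have "[a * (b * t) ^ 2 = c] (mod int p)" by simp
  from cong_square_multiple_lift[OF p c this, of "r - 1"]
  obtain s where s: "[a * s ^ 2 = c] (mod int p ^ r)" using r by auto
  have "[a * s ^ 2 = c] (mod int p)" using s r cong_dvd_modulus[OF s, of "int p"] by auto
  then have "\<not> int p dvd a * s ^ 2" using c by (simp add: cong_dvd_iff)
  then have "\<not> int p dvd s" by (auto simp: power2_eq_square)
  then have "coprime (int p) s" using p by (simp add: prime_imp_coprime)
  then have "coprime s (int p ^ r)" by (simp add: coprime_commute)
  with s that show ?thesis by blast
qed

section \<open>Values of binary quadratic forms of discriminant \<open>p ^ r\<close>\<close>

text \<open>A prime \<open>l\<close> dividing \<open>m\<close> has \<open>p ^ r\<close>, hence \<open>p\<close>, as a square modulo \<open>l\<close>; since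
  \<open>p\<close> is congruent to 1 modulo 4, reciprocity makes \<open>l\<close> a square modulo \<open>p\<close>.\<close>

lemma Legendre_of_represented:
  fixes m h g :: int
  assumes p: "prime p" "[p = 1] (mod 4)" and r: "odd r"
    and m: "odd m" "\<not> int p dvd m" and disc: "h ^ 2 - 4 * m * g = int p ^ r"
  shows "Legendre m (int p) = 1"
proof -
  have odd: "odd p" using p(2) unfolding cong_def by presburger
  have p2: "2 < p" using odd p(1) prime_ge_2_nat[of p] by (cases "p = 2") auto
  have l: "Legendre l (int p) = 1" if l: "prime l" "l dvd m" for l :: int
  proof -
    obtain l' where l': "l = int l'" using l(1) prime_ge_0_int[of l] zero_le_imp_eq_int by blast
    have pl': "prime l'" using l(1) l' by simp
    have ol: "odd l'" using l(2) m(1) l' by (metis dvd_trans even_of_nat)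
    then have l2: "2 < l'" using pl' prime_ge_2_nat[of l'] by (cases "l' = 2") auto
    have ne: "p \<noteq> l'" using l(2) m(2) l' by auto
    have nd: "\<not> int l' dvd int p"
      using ne pl' p(1) primes_dvd_imp_eq[of l' p] by auto
    have "[h ^ 2 = int p ^ r] (mod int l')"
    proof -
      have "h ^ 2 - int p ^ r = m * (4 * g)" using disc by simp
      then show ?thesis using l(2) l' unfolding cong_iff_dvd_diff by simp
    qed
    moreover have "\<not> int l' dvd int p ^ r"
      using nd pl' prime_dvd_power[of "int l'" "int p" r] by auto
    ultimately have 1: "Legendre (int p ^ r) (int l') = 1"
      unfolding Legendre_def QuadRes_def by (auto simp: cong_0_iff)
    \<comment> \<open>For odd \<open>r\<close> the power \<open>p ^ r\<close> is \<open>p\<close>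
      times a square, so both have the same symbol modulo \<open>l'\<close>.\<close>
    obtain k where k: "r = Suc (2 * k)" using r by (metis oddE Suc_eq_plus1)
    have "int p ^ r = int p * (int p ^ k) ^ 2" unfolding k by (simp add: power_mult mult.commute)
    moreover have "\<not> int l' dvd int p ^ k"
      using nd pl' prime_dvd_power[of "int l'" "int p" k] by auto
    ultimately have "Legendre (int p) (int l') = 1"
      using 1 Legendre_mult[OF pl' ol, of "int p" "(int p ^ k) ^ 2"]
        Legendre_square[of l' "int p ^ k"] pl' by simp
    moreover have "even ((p - 1) div 2)" using p(2) odd unfolding cong_def by presburger
    then have "Legendre (int p) (int l') * Legendre (int l') (int p) = 1"
      using Quadratic_Reciprocity[OF p(1) p2 pl' l2 ne] by simp
    ultimately show ?thesis using l' by simp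
  qed
  \<comment> \<open>Multiplicativity extends the result from the prime divisors of \<open>m\<close>
    to all divisors. The sign does no harm, because -1 is a square modulo \<open>p\<close>.\<close>
  have "x dvd m \<Longrightarrow> Legendre x (int p) = 1" for x
  proof (induction x rule: prime_divisors_induct)
    case zero
    then show ?case using m by auto
  next
    case (unit x)
    then have "x = 1 \<or> x = - 1" by auto
    moreover have "Legendre 1 (int p) = 1"
      using Legendre_square[of p 1] p(1) p2 by auto
    ultimately show ?case using Legendre_minus_1[OF p(1) odd] p(2) by auto
  next
    case (factor q x)
    then show ?case using Legendre_mult[OF p(1) odd, of q x] l[of q]
      by (metis dvd_mult_left dvd_mult_right mult_1)
  qed
  then show ?thesis by simp
qed

text \<open>The argument is moved within its class modulo \<open>p\<close> until the value is odd,
  and the common factor of its coordinates is removed, which divides the value by a square. A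
  primitive vector extends to a unimodular matrix, so the value is the leading coefficient of an
  equivalent form and \<open>Legendre_of_represented\<close> applies.\<close>

lemma Legendre_of_binary_form:
  fixes \<alpha> \<beta> \<gamma> x y :: int
  assumes p: "prime p" "[p = 1] (mod 4)" and r: "odd r"
    and disc: "\<beta> ^ 2 - 4 * \<alpha> * \<gamma> = int p ^ r"
    and m: "\<not> int p dvd \<alpha> * x ^ 2 + \<beta> * x * y + \<gamma> * y ^ 2"
  shows "Legendre (\<alpha> * x ^ 2 + \<beta> * x * y + \<gamma> * y ^ 2) (int p) = 1"
proof -
  define f where "f x y = \<alpha> * x ^ 2 + \<beta> * x * y + \<gamma> * y ^ 2" for x y
  have op: "odd p" using p(2) unfolding cong_def by presburger
  have "odd (\<beta> ^ 2 - 4 * \<alpha> * \<gamma>)" unfolding disc using op by simp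
  then have ob: "odd \<beta>" by simp
  \<comment> \<open>The odd discriminant makes \<beta> odd, so one of the vectors (1,0), (0,1),
    (1,1) has an odd value.\<close>
  have "\<exists>u v. odd (f u v)"
  proof (cases "odd \<alpha> \<or> odd \<gamma>")
    case True
    moreover have "f 1 0 = \<alpha>" "f 0 1 = \<gamma>" unfolding f_def by auto
    ultimately show ?thesis by metis
  next
    case False
    then have "odd (f 1 1)" using ob unfolding f_def by simp
    then show ?thesis by blast
  qed
  then obtain u v where uv: "odd (f u v)" by blast
  \<comment> \<open>Because \<open>p\<close> is odd, this vector agrees with \<open>(x, y)\<close>
    modulo \<open>p\<close> and with \<open>(u, v)\<close> modulo 2.\<close>
  define x' y' where "x' = x + int p * (u - x)" and "y' = y + int p * (v - y)"
  have "even (x' - u)" "even (y' - v)" using op unfolding x'_def y'_def by auto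
  then have "odd (f x' y')" using uv unfolding f_def by auto
  have "[x' = x] (mod int p)" "[y' = y] (mod int p)" unfolding x'_def y'_def
    by (simp_all add: cong_iff_dvd_diff)
  then have "[f x' y' = f x y] (mod int p)"
    unfolding f_def by (intro cong_add cong_mult cong_pow cong_refl)
  then have L': "Legendre (f x' y') (int p) = Legendre (f x y) (int p)" by (rule Legendre_cong)
  have nd': "\<not> int p dvd f x' y'"
    using m cong_dvd_iff[OF \<open>[f x' y' = f x y] (mod int p)\<close>] unfolding f_def by simp
  define g where "g = gcd x' y'"
  have "g \<noteq> 0"
  proof
    assume "g = 0"
    then have "f x' y' = 0" unfolding g_def f_def by simp
    then show False using nd' by simp
  qed
  then obtain x1 y1 where xy1: "x' = x1 * g" "y' = y1 * g" "coprime x1 y1"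
    unfolding g_def by (metis gcd_coprime_exists)
  have fg: "f x' y' = g ^ 2 * f x1 y1"
    unfolding f_def xy1 by (simp add: power2_eq_square algebra_simps)
  have o1: "odd (f x1 y1)" using \<open>odd (f x' y')\<close> unfolding fg by simp
  have nd1: "\<not> int p dvd f x1 y1" and ndg: "\<not> int p dvd g"
    using nd' unfolding fg by (auto simp: power2_eq_square)
  obtain s t where st: "s * x1 + t * y1 = 1"
    using bezout_int[of x1 y1] xy1(3) by auto
  \<comment> \<open>\<open>h\<close> is the middle coefficient of the form in the basis
    \<open>(x1, y1)\<close>, \<open>(- t, s)\<close>, whose determinant
    \<open>s * x1 + t * y1\<close> is 1; the discriminant is therefore preserved.\<close>
  define h where "h = 2 * \<alpha> * x1 * (- t) + \<beta> * (x1 * s - y1 * t) + 2 * \<gamma> * y1 * s"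
  have "h ^ 2 - 4 * f x1 y1 * f (- t) s = (\<beta> ^ 2 - 4 * \<alpha> * \<gamma>) * (s * x1 + t * y1) ^ 2"
    unfolding h_def f_def by (simp add: power2_eq_square algebra_simps)
  also have "\<dots> = int p ^ r" using st disc by simp
  finally have "Legendre (f x1 y1) (int p) = 1"
    by (rule Legendre_of_represented[OF p r o1 nd1])
  then have "Legendre (f x' y') (int p) = 1"
    unfolding fg Legendre_mult[OF p(1) op] using Legendre_square[OF ndg p(1)] by simp
  then show ?thesis using L' unfolding f_def by simp
qed

section \<open>Lattices given by Gram matrices\<close>

lemma int_basis_std_lattice:
  "int_basis (range (\<lambda>i. axis i (1::real))) (std_lattice :: (real ^ 'n) set)"
proof -
  let ?e = "\<lambda>i. axis i (1::real) :: real ^ 'n"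
  have inj: "inj ?e" by (auto simp: inj_def axis_eq_axis)
  have "range ?e = Basis" by (auto simp: Basis_vec_def)
  then have "independent (range ?e)" by (simp add: independent_Basis)
  moreover have "std_lattice = range (\<lambda>c. \<Sum>x\<in>range ?e. real_of_int (c x) *\<^sub>R x)"
  proof (intro Set.set_eqI iffI)
    fix x :: "real ^ 'n" assume "x \<in> std_lattice"
    then have fl: "real_of_int \<lfloor>x $ i\<rfloor> = x $ i" for i
      unfolding std_lattice_def by (auto elim: Ints_cases)
    have "(\<Sum>z\<in>range ?e. real_of_int \<lfloor>x \<bullet> z\<rfloor> *\<^sub>R z) = (\<Sum>i\<in>UNIV. x $ i *\<^sub>R ?e i)"
      by (simp add: sum.reindex[OF inj] inner_axis fl)
    also have "\<dots> = x"
      by (simp add: vec_eq_iff axis_def if_distrib cong: if_cong)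
    finally show "x \<in> range (\<lambda>c. \<Sum>x\<in>range ?e. real_of_int (c x) *\<^sub>R x)"
      by (intro range_eqI[where x = "\<lambda>z. \<lfloor>x \<bullet> z\<rfloor>"]) simp
  next
    fix x assume "x \<in> range (\<lambda>c. \<Sum>x\<in>range ?e. real_of_int (c x) *\<^sub>R x)"
    then obtain c where c: "x = (\<Sum>x\<in>range ?e. real_of_int (c x) *\<^sub>R x)" by blast
    show "x \<in> std_lattice" unfolding c std_lattice_def
      by (auto simp: axis_def intro!: Ints_sum Ints_mult)
  qed
  ultimately show ?thesis unfolding int_basis_def by simp
qed

lemma lattice_rank_std: "lattice_rank (std_lattice :: (real ^ 'n) set) = CARD('n)"
  unfolding lattice_rank_eq[OF int_basis_std_lattice]
  by (rule card_image) (auto simp: inj_def axis_eq_axis)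

text \<open>Conjugation by \<open>e\<close> matches permutations of the index type with permutations
  of the basis and preserves the sign. This links the Leibniz sum over a set of vectors to the
  library's \<open>det\<close>.\<close>

lemma gram_det_range:
  fixes e :: "'n::finite \<Rightarrow> 'v"
  assumes e: "inj e"
  shows "gram_det B (range e) = det (\<chi> i j. B (e i) (e j))"
proof -
  have bij: "bij_betw (map_permutation UNIV e) {\<pi>. \<pi> permutes UNIV} {\<pi>. \<pi> permutes range e}"
  proof (rule bij_betw_byWitness[where f' = "map_permutation (range e) (inv_into UNIV e)"])
    show "\<forall>\<pi>\<in>{\<pi>. \<pi> permutes UNIV}.
        map_permutation (range e) (inv_into UNIV e) (map_permutation UNIV e \<pi>) = \<pi>"
      using e by (auto intro!: map_permutation_compose_inv simp: bij_betw_def)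
    show "\<forall>\<pi>\<in>{\<pi>. \<pi> permutes range e}.
        map_permutation UNIV e (map_permutation (range e) (inv_into UNIV e) \<pi>) = \<pi>"
      using e bij_betw_inv_into[of e UNIV "range e"]
      by (auto intro!: map_permutation_compose_inv simp: bij_betw_def)
    show "map_permutation UNIV e ` {\<pi>. \<pi> permutes UNIV} \<subseteq> {\<pi>. \<pi> permutes range e}"
      using e by (auto intro!: map_permutation_permutes simp: bij_betw_def)
    show "map_permutation (range e) (inv_into UNIV e) ` {\<pi>. \<pi> permutes range e} \<subseteq> {\<pi>. \<pi> permutes UNIV}"
      using e bij_betw_inv_into[of e UNIV "range e"]
      by (auto intro!: map_permutation_permutes simp: bij_betw_def)
  qed
  have "gram_det B (range e) = (\<Sum>\<pi> | \<pi> permutes UNIV.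
      of_int (sign (map_permutation UNIV e \<pi>)) * (\<Prod>x\<in>range e. B x (map_permutation UNIV e \<pi> x)))"
    unfolding gram_det_def by (rule sum.reindex_bij_betw[OF bij, symmetric])
  also have "\<dots> = (\<Sum>\<pi> | \<pi> permutes UNIV. of_int (sign \<pi>) * (\<Prod>i\<in>UNIV. B (e i) (e (\<pi> i))))"
    using e by (intro sum.cong refl)
      (simp add: sign_map_permutation prod.reindex map_permutation_apply)
  finally show ?thesis unfolding det_def by simp
qed

lemma gram_form_eq_sum:
  "gram_form G x y = (\<Sum>i\<in>UNIV. \<Sum>j\<in>UNIV. x $ i * G $ i $ j * y $ j)"
  unfolding gram_form_def inner_vec_def matrix_vector_mult_def
  by (simp add: sum_distrib_left mult.assoc)

lemma span_std_lattice: "span (std_lattice :: (real ^ 'n) set) = UNIV"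
proof -
  have "range (\<lambda>i. axis i (1::real)) = (Basis :: (real ^ 'n) set)" by (auto simp: Basis_vec_def)
  moreover have "span (std_lattice :: (real ^ 'n) set) = span (range (\<lambda>i. axis i (1::real)))"
    by (rule int_basis_span[OF int_basis_std_lattice])
  ultimately show ?thesis by simp
qed

lemma dual_std_lattice:
  assumes sym: "\<And>i j. G $ i $ j = G $ j $ i"
  shows "dual_lattice std_lattice (gram_form G) = {x. \<forall>i. (G *v x) $ i \<in> \<int>}"
proof (intro Set.set_eqI iffI)
  have comm: "gram_form G x y = gram_form G y x" for x y
    unfolding gram_form_eq_sum by (subst sum.swap) (simp add: sym mult.commute mult.left_commute)
  {
    fix x assume x: "x \<in> dual_lattice std_lattice (gram_form G)"
    have "(G *v x) $ i \<in> \<int>" for i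
    proof -
      have "axis i 1 \<in> (std_lattice :: (real ^ 'a) set)"
        unfolding std_lattice_def by (simp add: axis_def)
      then have "gram_form G (axis i 1) x \<in> \<int>"
        using x unfolding dual_lattice_def by (auto simp: comm[of "axis i 1" x])
      then show ?thesis unfolding gram_form_def by (simp add: inner_axis')
    qed
    then show "x \<in> {x. \<forall>i. (G *v x) $ i \<in> \<int>}" by simp
  next
    fix x assume x: "x \<in> {x. \<forall>i. (G *v x) $ i \<in> \<int>}"
    have "gram_form G x w \<in> \<int>" if "w \<in> std_lattice" for w
    proof -
      have "gram_form G w x \<in> \<int>"
        using x that unfolding gram_form_def inner_vec_def std_lattice_def
        by (auto intro!: Ints_sum Ints_mult)
      then show ?thesis by (simp add: comm[of x w])
    qed
    then show "x \<in> dual_lattice std_lattice (gram_form G)"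
      unfolding dual_lattice_def by (simp add: span_std_lattice)
  }
qed

text \<open>In the norm of an integral vector the off-diagonal terms occur in equal pairs by
  symmetry, and the diagonal terms are even.\<close>

lemma even_std_lattice:
  assumes sym: "\<And>i j. G $ i $ j = G $ j $ i" and int: "\<And>i j. G $ i $ j \<in> \<int>"
    and diag: "\<And>i. \<exists>m::int. G $ i $ i = 2 * of_int m"
  shows "even_lattice (std_lattice :: (real ^ 'n) set) (gram_form G)"
  unfolding even_lattice_def int_lattice_def
proof (intro conjI ballI allI)
  show "\<exists>b. int_basis b (std_lattice :: (real ^ 'n) set)" using int_basis_std_lattice by blast
  show "bilinear (gram_form G)"
    unfolding bilinear_def linear_iff gram_form_def
    by (simp add: inner_add_left inner_add_right matrix_vector_right_distrib
        matrix_vector_mult_scaleR)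
  show "gram_form G x y = gram_form G y x" for x y
    unfolding gram_form_eq_sum by (subst sum.swap) (simp add: sym mult.commute mult.left_commute)
  show "gram_form G x y \<in> \<int>" if "x \<in> std_lattice" "y \<in> std_lattice" for x y
    using that int unfolding gram_form_eq_sum std_lattice_def
    by (auto intro!: Ints_sum Ints_mult)
  fix x :: "real ^ 'n" assume x: "x \<in> std_lattice"
  define c where "c i = \<lfloor>x $ i\<rfloor>" for i
  have c: "x $ i = of_int (c i)" for i
    using x unfolding std_lattice_def c_def by (auto elim: Ints_cases)
  define g where "g i j = \<lfloor>G $ i $ j\<rfloor>" for i j
  have g: "G $ i $ j = of_int (g i j)" for i j
    using int[of i j] unfolding g_def by (auto elim: Ints_cases)
  have ge: "even (g i i)" for i
  proof -
    obtain m :: int where "G $ i $ i = of_int (2 * m)" using diag[of i] by auto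
    then have "g i i = 2 * m" using g[of i i] by (simp only: of_int_eq_iff)
    then show ?thesis by simp
  qed
  have gs: "g i j = g j i" for i j using sym[of i j] g by simp
  \<comment> \<open>Summing over a subset \<open>A\<close> of the indices allows an induction:
    adding an index contributes one diagonal term and twice a sum of off-diagonal terms.\<close>
  define S where "S A = (\<Sum>i\<in>A. \<Sum>j\<in>A. c i * g i j * c j)" for A
  have "even (S A)" if "finite A" for A
    using that
  proof (induction A rule: finite_induct)
    case empty
    then show ?case by (simp add: S_def)
  next
    case (insert k A)
    have "(\<Sum>i\<in>A. c i * g i k * c k) = (\<Sum>j\<in>A. c k * g k j * c j)"
      by (intro sum.cong refl) (simp add: gs[of k])
    then have "S (insert k A) = c k * g k k * c k + 2 * (\<Sum>j\<in>A. c k * g k j * c j) + S A"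
      unfolding S_def using insert(1,2) by (simp add: sum.distrib)
    then show ?case using insert(3) ge[of k] by simp
  qed
  then obtain m where "S UNIV = 2 * m" by (auto elim: evenE)
  moreover have "gram_form G x x = of_int (S UNIV)"
    unfolding gram_form_eq_sum S_def by (simp add: c g)
  ultimately show "\<exists>k::int. gram_form G x x = 2 * of_int k" by auto
qed

section \<open>A criterion for a cyclic discriminant module\<close>

text \<open>By \<open>dual\<close>, a dual vector is integral except for its \<open>k\<close>-th
  coordinate, which is a multiple of \<open>1 / n\<close>; by \<open>row\<close> and symmetry the
  vector with \<open>1 / n\<close> in place \<open>k\<close> is dual. It thus generates the
  discriminant module, and by \<open>kk\<close> its half norm is \<open>c / n\<close>.
  Multiplication by \<open>s\<close> replaces \<open>c\<close> by \<open>a\<close>.\<close>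

lemma cyclic_discriminantI:
  fixes G :: "real ^ 'n ^ 'n" and k :: 'n and n :: nat and a c s :: int
  assumes n: "n > 0"
    and sym: "\<And>i j. G $ i $ j = G $ j $ i" and int: "\<And>i j. G $ i $ j \<in> \<int>"
    and diag: "\<And>i. \<exists>m::int. G $ i $ i = 2 * of_int m"
    and kk: "G $ k $ k = 2 * of_int c * real n"
    and row: "\<And>j. \<exists>t::int. G $ k $ j = real n * of_int t"
    and dual: "\<And>x. (\<And>i. (G *v x) $ i \<in> \<int>) \<Longrightarrow> real n * x $ k \<in> \<int> \<and> (\<forall>i. i \<noteq> k \<longrightarrow> x $ i \<in> \<int>)"
    and s: "[a * s ^ 2 = c] (mod int n)" "coprime s (int n)"
  shows "even_lattice std_lattice (gram_form G) \<and> nondegenerate_lattice std_lattice (gram_form G)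
    \<and> isometric (discriminant_module std_lattice (gram_form G)) (cyclic_qm n a)"
proof -
  let ?L = "std_lattice :: (real ^ 'n) set" and ?B = "gram_form G"
  let ?D = "dual_lattice ?L ?B"
  have even: "even_lattice ?L ?B" by (rule even_std_lattice[OF sym int diag])
  \<comment> \<open>Nondegeneracy also follows from \<open>dual\<close>: every real multiple of a
    kernel vector satisfies its premise, so a nonzero coordinate could be scaled until the number
    required to be integral equals 1/2.\<close>
  have "x = 0" if x: "G *v x = 0" for x
  proof -
    have t: "real n * (t * x $ k) \<in> \<int> \<and> (\<forall>i. i \<noteq> k \<longrightarrow> t * x $ i \<in> \<int>)" for t
      using dual[of "t *\<^sub>R x"] x by (simp add: matrix_vector_mult_scaleR)
    have half: "(1 / 2 :: real) \<notin> \<int>"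
    proof
      assume "(1 / 2 :: real) \<in> \<int>"
      then obtain z :: int where "1 / 2 = real_of_int z" by (auto elim: Ints_cases)
      then have "real_of_int (2 * z) = real_of_int 1" by simp
      then have "2 * z = 1" by (simp only: of_int_eq_iff)
      then show False by presburger
    qed
    have "x $ i = 0" for i
    proof (rule ccontr)
      assume i: "x $ i \<noteq> 0"
      show False
      proof (cases "i = k")
        case True
        then show ?thesis using t[of "1 / (2 * real n * x $ k)"] i n half by simp
      next
        case False
        then have "1 / (2 * x $ i) * x $ i \<in> \<int>" using t by blast
        then show ?thesis using i half by simp
      qed
    qed
    then show ?thesis by (simp add: vec_eq_iff)
  qed
  then have "invertible G"
    by (simp add: invertible_left_inverse matrix_left_invertible_ker)
  then have "det G \<noteq> 0" by (simp add: invertible_det_nz)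
  moreover have "gram_det ?B (range (\<lambda>i. axis i 1)) = det G"
  proof -
    have "?B (axis i 1) (axis j 1) = G $ i $ j" for i j
      unfolding gram_form_def by (simp add: inner_axis' matrix_vector_mult_basis column_def)
    then show ?thesis by (subst gram_det_range) (auto simp: inj_def axis_eq_axis)
  qed
  ultimately have nondeg: "nondegenerate_lattice ?L ?B"
    using even int_basis_std_lattice unfolding nondegenerate_lattice_def even_lattice_def by metis
  \<comment> \<open>On dual vectors the floor is exact, so \<phi> is \<open>s\<close> times the
    numerator of the \<open>k\<close>-th coordinate over \<open>n\<close>.\<close>
  define \<phi> where "\<phi> x = s * \<lfloor>real n * x $ k\<rfloor>" for x :: "real ^ 'n"
  have Dn: "real_of_int \<lfloor>real n * x $ k\<rfloor> = real n * x $ k" if "x \<in> ?D" for x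
    using that dual[of x] unfolding dual_std_lattice[OF sym] by (auto elim: Ints_cases)
  have Di: "x $ i \<in> \<int>" if "x \<in> ?D" "i \<noteq> k" for x i
    using that dual[of x] unfolding dual_std_lattice[OF sym] by auto
  have "isometric (discriminant_module ?L ?B) (cyclic_qm n a)"
  proof (rule isometric_cyclicI[OF even n, where \<phi> = \<phi>])
    fix x y assume xy: "x \<in> ?D" "y \<in> ?D"
    have "real_of_int \<lfloor>real n * (x + y) $ k\<rfloor>
      = real_of_int (\<lfloor>real n * x $ k\<rfloor> + \<lfloor>real n * y $ k\<rfloor>)"
      unfolding of_int_add Dn[OF xy(1)] Dn[OF xy(2)] Dn[OF dual_lattice_add[OF even xy]]
      by (simp add: distrib_left)
    then have "\<lfloor>real n * (x + y) $ k\<rfloor> = \<lfloor>real n * x $ k\<rfloor> + \<lfloor>real n * y $ k\<rfloor>"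
      by (simp only: of_int_eq_iff)
    then show "[\<phi> (x + y) = \<phi> x + \<phi> y] (mod int n)"
      unfolding \<phi>_def by (simp add: distrib_left)
  next
    fix x assume x: "x \<in> ?D"
    have "[\<phi> x = 0] (mod int n) \<longleftrightarrow> int n dvd \<lfloor>real n * x $ k\<rfloor>"
      using s(2) unfolding \<phi>_def by (simp add: cong_0_iff coprime_dvd_mult_right_iff coprime_commute)
    also have "\<dots> \<longleftrightarrow> x $ k \<in> \<int>"
    proof
      assume "int n dvd \<lfloor>real n * x $ k\<rfloor>"
      then obtain z where "\<lfloor>real n * x $ k\<rfloor> = int n * z" by (elim dvdE)
      then have "real n * x $ k = real n * of_int z" using Dn[OF x] by auto
      then show "x $ k \<in> \<int>" using n by simp
    next
      assume "x $ k \<in> \<int>"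
      then obtain z where "x $ k = of_int z" by (auto elim: Ints_cases)
      then have "real n * x $ k = of_int (int n * z)" by simp
      then have "\<lfloor>real n * x $ k\<rfloor> = int n * z" by (simp only: floor_of_int)
      then show "int n dvd \<lfloor>real n * x $ k\<rfloor>" by simp
    qed
    also have "\<dots> \<longleftrightarrow> x \<in> ?L"
    proof
      assume k: "x $ k \<in> \<int>"
      have "x $ i \<in> \<int>" for i using k Di[OF x, of i] by (cases "i = k") auto
      then show "x \<in> ?L" unfolding std_lattice_def by blast
    qed (simp add: std_lattice_def)
    finally show "[\<phi> x = 0] (mod int n) \<longleftrightarrow> x \<in> ?L" .
  next
    \<comment> \<open>With \<open>u\<close> inverse to \<open>s\<close> modulo \<open>n\<close>, the
      vector with \<open>u / n\<close> in place \<open>k\<close> has \<phi>-value congruent to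
      1.\<close>
    obtain u where u: "[s * u = 1] (mod int n)" using s(2) cong_solve_coprime_int by blast
    let ?x = "axis k (of_int u / real n) :: real ^ 'n"
    have "(G *v ?x) $ i \<in> \<int>" for i
    proof -
      obtain t :: int where t: "G $ k $ i = real n * of_int t" using row by blast
      have "(G *v ?x) $ i = G $ i $ k * (of_int u / real n)"
        unfolding matrix_vector_mult_def by (simp add: axis_def if_distrib cong: if_cong)
      also have "\<dots> = of_int (t * u)" using t n sym[of i k] by simp
      finally show ?thesis by simp
    qed
    then have "?x \<in> ?D" unfolding dual_std_lattice[OF sym] by simp
    moreover have "\<phi> ?x = s * u" unfolding \<phi>_def using n by (simp add: axis_def)
    ultimately show "\<exists>x\<in>?D. [\<phi> x = 1] (mod int n)" using u by metis
  next
    fix x assume x: "x \<in> ?D"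
    define z where "z = \<lfloor>real n * x $ k\<rfloor>"
    have z: "real_of_int z = real n * x $ k" using Dn[OF x] unfolding z_def .
    \<comment> \<open>Dropping the integral coordinates changes \<open>x\<close> by a lattice
      vector, hence the half norm by an integer; what remains is \<open>c * z^2 / n\<close>, to be
      compared with \<open>a * (s * z)^2 / n\<close>.\<close>
    let ?y = "axis k (x $ k) :: real ^ 'n"
    have h: "x - ?y \<in> ?L" using Di[OF x] unfolding std_lattice_def by (auto simp: axis_def)
    have y: "?y \<in> ?D"
      using dual_lattice_diff[OF even x even_lattice_subset_dual[OF even h]] by simp
    have "?B ?y ?y = x $ k * (G $ k $ k * x $ k)"
      unfolding gram_form_def
      by (simp add: inner_axis' matrix_vector_mult_def, simp add: axis_def if_distrib cong: if_cong)
    then have By: "?B ?y ?y / 2 = of_int c / real n * of_int z ^ 2"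
      unfolding kk z using n by (simp add: power2_eq_square)
    have Bxy: "?B x x / 2 - ?B ?y ?y / 2 \<in> \<int>"
      using half_norm_mod_lattice[OF even y h] by simp
    obtain w where "a * s ^ 2 = c + int n * w"
      using cong_sym[OF s(1)] unfolding cong_iff_lin by blast
    then have w: "real_of_int a * of_int s ^ 2 = of_int c + real n * of_int w"
      by (metis of_int_add of_int_mult of_int_of_nat_eq of_int_power)
    have "real_of_int a / real n * of_int (\<phi> x) ^ 2
        = (real_of_int a * of_int s ^ 2) / real n * of_int z ^ 2"
      unfolding \<phi>_def z_def by (simp add: power_mult_distrib)
    also have "\<dots> = ?B ?y ?y / 2 + of_int (w * z ^ 2)"
      unfolding w By using n by (simp add: field_simps)
    finally have eq: "?B x x / 2 - real_of_int a / real n * of_int (\<phi> x) ^ 2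
      = (?B x x / 2 - ?B ?y ?y / 2) - of_int (w * z ^ 2)" by simp
    show "?B x x / 2 - real_of_int a / real n * of_int (\<phi> x) ^ 2 \<in> \<int>"
      unfolding eq by (rule Ints_diff[OF Bxy Ints_of_int])
  qed
  with even nondeg show ?thesis by blast
qed

section \<open>Lattices of small rank\<close>

text \<open>In rank 0 the dual is zero, too small for a module of order above 1. In rank 1 half the
  generator \<open>e\<close> is dual because \<open>C e e\<close> is even; its class is killed by 2,
  hence trivial as \<open>n\<close> is odd, yet \<open>e / 2\<close> is not in
  \<open>M\<close>.\<close>

lemma lattice_rank_ge_2:
  assumes even: "even_lattice M C" and n: "odd n" "n > 1"
    and iso: "isometric (discriminant_module M C) (cyclic_qm n a)"
  shows "lattice_rank M \<ge> 2"
proof (rule ccontr)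
  assume "\<not> lattice_rank M \<ge> 2"
  moreover obtain b where b: "int_basis b M" using even_lattice_basis[OF even] .
  ultimately have card: "card b < 2" using lattice_rank_eq by fastforce
  have n0: "n > 0" using n by simp
  obtain \<phi> :: "'a \<Rightarrow> int" where
    add: "\<And>x y. x \<in> dual_lattice M C \<Longrightarrow> y \<in> dual_lattice M C \<Longrightarrow>
      [\<phi> (x + y) = \<phi> x + \<phi> y] (mod int n)"
    and ker: "\<And>x. x \<in> dual_lattice M C \<Longrightarrow> [\<phi> x = 0] (mod int n) \<longleftrightarrow> x \<in> M"
    and one: "\<exists>x\<in>dual_lattice M C. [\<phi> x = 1] (mod int n)"
    using isometric_cyclic_imp[OF even n0 iso] by metis
  consider "b = {}" | e where "b = {e}"
    using card b unfolding int_basis_def by (metis One_nat_def card_0_eq card_1_singletonE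
        less_2_cases)
  then show False
  proof cases
    case 1
    obtain x where x: "x \<in> dual_lattice M C" "[\<phi> x = 1] (mod int n)" using one by blast
    have "x = 0" using x(1) int_basis_span[OF b] 1 unfolding dual_lattice_def by simp
    then have "x \<in> M" using even_lattice_closed(1)[OF even] by simp
    then have "[\<phi> x = 0] (mod int n)" using ker[OF x(1)] by simp
    then have "[1 = 0] (mod int n)" using x(2) by (simp add: cong_def)
    then show False using n by (simp add: cong_def)
  next
    case (2 e)
    have M: "M = range (\<lambda>c. real_of_int (c e) *\<^sub>R e)" and e: "e \<noteq> 0"
      using b 2 unfolding int_basis_def by (auto simp: dependent_single)
    let ?h = "(1 / 2) *\<^sub>R e"
    have eM: "e \<in> M" using int_basis_subset[OF b] 2 by blast
    obtain k :: int where k: "C e e = 2 * of_int k" using even eM unfolding even_lattice_def by blast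
    have "C ?h w \<in> \<int>" if "w \<in> M" for w
      using that k unfolding M
      by (auto simp: bilinear_lmul[OF even_lattice_bilinear[OF even]]
          bilinear_rmul[OF even_lattice_bilinear[OF even]])
    then have h: "?h \<in> dual_lattice M C"
      unfolding dual_lattice_def using eM by (auto intro: span_scale span_base)
    have "?h + ?h = e" by (simp flip: scaleR_add_left)
    then have "[\<phi> e = \<phi> ?h + \<phi> ?h] (mod int n)" using add[OF h h] by simp
    moreover have "[\<phi> e = 0] (mod int n)"
      using ker[OF even_lattice_subset_dual[OF even eM]] eM by simp
    ultimately have "int n dvd 2 * \<phi> ?h"
      by (simp add: cong_def mod_eq_0_iff_dvd)
    moreover have "coprime (int n) 2" using n(1) by simp
    ultimately have "int n dvd \<phi> ?h" by (simp add: coprime_dvd_mult_right_iff)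
    then have "?h \<in> M" using ker[OF h] by (simp add: cong_0_iff)
    then obtain c :: int where "?h = real_of_int c *\<^sub>R e" unfolding M by auto
    then have "real_of_int (2 * c) = real_of_int 1" using e by simp
    then have "2 * c = 1" by (simp only: of_int_eq_iff)
    then show False by presburger
  qed
qed

section \<open>Rank 2 for \<open>p\<close> congruent to 1 modulo 4\<close>

lemma gram_det_pair:
  assumes "e \<noteq> f"
  shows "gram_det B {e, f} = B e e * B f f - B e f * B f e"
proof -
  let ?g = "\<lambda>i::2. if i = 1 then e else f"
  have 2: "(2::2) \<noteq> 1" by simp
  have "{e, f} = range ?g" using 2 by (auto simp: UNIV_2)
  moreover have "inj ?g" using assms by (auto simp: inj_def forall_2)
  ultimately have "gram_det B {e, f} = det (\<chi> i j. B (?g i) (?g j))"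
    using gram_det_range[of ?g B] by simp
  then show ?thesis using 2 by (simp add: det_2)
qed

text \<open>In the coordinates \<open>(C x e, C x f)\<close> the dual lattice is the integral plane
  with half norm \<open>N / d\<close>, where \<open>d\<close> is the Gram determinant and
  \<open>N\<close> an integral form of discriminant \<open>- d\<close>. Cyclicity gives
  \<open>\<bar>d\<bar> = n\<close>, a congruence modulo 4 gives \<open>d = - n\<close>, and a
  generator shows that \<open>N\<close> represents \<open>- a\<close> modulo \<open>p\<close> up to
  a square prime to \<open>p\<close>.\<close>

lemma rank_2_discriminant_imp_Legendre:
  fixes M :: "'v::real_vector set"
  assumes p: "prime p" "[p = 1] (mod 4)" and r: "odd r" and a: "\<not> int p dvd a"
    and even: "even_lattice M C" and nondeg: "nondegenerate_lattice M C"
    and rank: "lattice_rank M = 2"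
    and iso: "isometric (discriminant_module M C) (cyclic_qm (p ^ r) a)"
  shows "Legendre a (int p) = 1"
proof -
  let ?D = "dual_lattice M C"
  define n where "n = p ^ r"
  have op: "odd p" using p(2) unfolding cong_def by presburger
  have n0: "n > 0" using p(1) prime_gt_0_nat unfolding n_def by simp
  have bil: "bilinear C" by (rule even_lattice_bilinear[OF even])
  note lin = bilinear_ladd[OF bil] bilinear_lmul[OF bil] bilinear_radd[OF bil] bilinear_rmul[OF bil]
    bilinear_lsub[OF bil]
  obtain b where b: "int_basis b M" "gram_det C b \<noteq> 0"
    using nondeg unfolding nondegenerate_lattice_def by blast
  then have "card b = 2" using rank lattice_rank_eq by metis
  then obtain e f where ef: "b = {e, f}" "e \<noteq> f" by (auto simp: card_2_iff)
  have eM: "e \<in> M" "f \<in> M" using int_basis_subset[OF b(1)] ef by auto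
  obtain \<alpha> \<gamma> \<beta> :: int where
    G: "C e e = 2 * of_int \<alpha>" "C f f = 2 * of_int \<gamma>" "C e f = of_int \<beta>" "C f e = of_int \<beta>"
    using even eM even_lattice_sym[OF even, of e f] unfolding even_lattice_def
    by (metis Ints_cases)
  define d where "d = 4 * \<alpha> * \<gamma> - \<beta> ^ 2"
  have "gram_det C b = of_int d"
    unfolding ef(1) gram_det_pair[OF ef(2)] d_def G by (simp add: power2_eq_square)
  then have d0: "d \<noteq> 0" using b(2) by auto
  have M: "x \<in> M \<longleftrightarrow> (\<exists>k l. x = real_of_int k *\<^sub>R e + real_of_int l *\<^sub>R f)" for x
  proof
    assume "x \<in> M"
    then obtain c :: "'v \<Rightarrow> int" where "x = (\<Sum>z\<in>b. real_of_int (c z) *\<^sub>R z)"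
      using b(1) unfolding int_basis_def by blast
    then have "x = real_of_int (c e) *\<^sub>R e + real_of_int (c f) *\<^sub>R f"
      using ef by simp
    then show "\<exists>k l. x = real_of_int k *\<^sub>R e + real_of_int l *\<^sub>R f" by blast
  next
    assume "\<exists>k l. x = real_of_int k *\<^sub>R e + real_of_int l *\<^sub>R f"
    then obtain k l where "x = real_of_int k *\<^sub>R e + real_of_int l *\<^sub>R f" by blast
    then have "x = (\<Sum>z\<in>b. real_of_int (if z = e then k else l) *\<^sub>R z)"
      using ef by simp
    then show "x \<in> M" using b(1) unfolding int_basis_def
      by (auto intro!: image_eqI[where x = "\<lambda>z. if z = e then k else l"])
  qed
  \<comment> \<open>The dual vector whose products with \<open>e\<close> and \<open>f\<close> are
    \<open>u1\<close> and \<open>u2\<close>: the inverse Gram matrix, written as adjugate over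
    determinant, applied to \<open>(u1, u2)\<close>.\<close>
  define X where "X u1 u2 = (of_int (2 * \<gamma> * u1 - \<beta> * u2) / of_int d) *\<^sub>R e
    + (of_int (2 * \<alpha> * u2 - \<beta> * u1) / of_int d) *\<^sub>R f" for u1 u2 :: int
  have rd: "real_of_int d = 4 * of_int \<alpha> * of_int \<gamma> - of_int \<beta> ^ 2" unfolding d_def by simp
  have rd0: "real_of_int d \<noteq> 0" using d0 by simp
  have Xe: "C (X u1 u2) e = of_int u1" and Xf: "C (X u1 u2) f = of_int u2" for u1 u2
  proof -
    have "C (X u1 u2) e = of_int d * of_int u1 / of_int d"
      unfolding X_def lin G by (simp add: rd power2_eq_square algebra_simps add_divide_distrib[symmetric]
          diff_divide_distrib[symmetric])
    then show "C (X u1 u2) e = of_int u1" using rd0 by simp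
    have "C (X u1 u2) f = of_int d * of_int u2 / of_int d"
      unfolding X_def lin G by (simp add: rd power2_eq_square algebra_simps add_divide_distrib[symmetric]
          diff_divide_distrib[symmetric])
    then show "C (X u1 u2) f = of_int u2" using rd0 by simp
  qed
  have XD: "X u1 u2 \<in> ?D" for u1 u2
  proof -
    have "C (X u1 u2) w \<in> \<int>" if "w \<in> M" for w
      using that unfolding M by (auto simp: lin Xe Xf)
    moreover have "X u1 u2 \<in> span M"
      unfolding X_def using eM by (intro span_add span_scale span_base)
    ultimately show ?thesis unfolding dual_lattice_def by simp
  qed
  have XQ: "C (X u1 u2) (X u1 u2) / 2
    = of_int (\<gamma> * u1 ^ 2 + (- \<beta>) * u1 * u2 + \<alpha> * u2 ^ 2) / of_int d" for u1 u2
  proof -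
    define N where "N = \<gamma> * u1 ^ 2 + (- \<beta>) * u1 * u2 + \<alpha> * u2 ^ 2"
    have "C (X u1 u2) (X u1 u2)
      = of_int (2 * \<gamma> * u1 - \<beta> * u2) / of_int d * of_int u1
        + of_int (2 * \<alpha> * u2 - \<beta> * u1) / of_int d * of_int u2"
      by (subst (2) X_def) (simp only: lin Xe Xf real_scaleR_def)
    also have "\<dots> = of_int ((2 * \<gamma> * u1 - \<beta> * u2) * u1 + (2 * \<alpha> * u2 - \<beta> * u1) * u2) / of_int d"
      by (simp add: add_divide_distrib)
    also have "(2 * \<gamma> * u1 - \<beta> * u2) * u1 + (2 * \<alpha> * u2 - \<beta> * u1) * u2 = 2 * N"
      unfolding N_def by (simp add: power2_eq_square algebra_simps)
    finally show ?thesis unfolding N_def[symmetric] by simp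
  qed
  have surj: "\<exists>u1 u2. y = X u1 u2" if y: "y \<in> ?D" for y
  proof -
    have "y \<in> span {e, f}"
      using y int_basis_span[OF b(1)] ef unfolding dual_lattice_def by simp
    then obtain s where "y - s *\<^sub>R e \<in> span {f}" unfolding span_breakdown_eq by blast
    then obtain t where "y - s *\<^sub>R e = t *\<^sub>R f" unfolding span_singleton by blast
    then have st: "y = s *\<^sub>R e + t *\<^sub>R f" by (simp add: diff_eq_eq add.commute)
    have "C y e \<in> \<int>" "C y f \<in> \<int>" using y eM unfolding dual_lattice_def by auto
    then obtain u1 u2 where u: "C y e = of_int u1" "C y f = of_int u2" by (auto elim!: Ints_cases)
    have "of_int (2 * \<gamma> * u1 - \<beta> * u2) = 2 * of_int \<gamma> * C y e - of_int \<beta> * C y f" unfolding u by simp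
    also have "\<dots> = s * of_int d" unfolding st lin G rd by (simp add: power2_eq_square algebra_simps)
    finally have s: "s = of_int (2 * \<gamma> * u1 - \<beta> * u2) / of_int d" using rd0 by (simp add: field_simps)
    have "of_int (2 * \<alpha> * u2 - \<beta> * u1) = 2 * of_int \<alpha> * C y f - of_int \<beta> * C y e" unfolding u by simp
    also have "\<dots> = t * of_int d" unfolding st lin G rd by (simp add: power2_eq_square algebra_simps)
    finally have t: "t = of_int (2 * \<alpha> * u2 - \<beta> * u1) / of_int d" using rd0 by (simp add: field_simps)
    show ?thesis unfolding st s t X_def by blast
  qed
  obtain \<phi> :: "'v \<Rightarrow> int" where
    add: "\<And>x y. x \<in> ?D \<Longrightarrow> y \<in> ?D \<Longrightarrow> [\<phi> (x + y) = \<phi> x + \<phi> y] (mod int n)"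
    and ker: "\<And>x. x \<in> ?D \<Longrightarrow> [\<phi> x = 0] (mod int n) \<longleftrightarrow> x \<in> M"
    and one: "\<exists>x\<in>?D. [\<phi> x = 1] (mod int n)"
    and Q: "\<And>x. x \<in> ?D \<Longrightarrow> C x x / 2 - of_int a / of_nat n * of_int (\<phi> x) ^ 2 \<in> \<int>"
    using isometric_cyclic_imp[OF even n0 iso[folded n_def]] by metis
  have scale: "[\<phi> (real m *\<^sub>R x) = int m * \<phi> x] (mod int n)" if "x \<in> ?D" for x m
    using additive_cong_scale[OF even add that] .
  obtain u1 u2 where u: "[\<phi> (X u1 u2) = 1] (mod int n)" using one surj by metis
  define \<psi> where "\<psi> = \<phi> (X u1 u2)"
  \<comment> \<open>Subtracting a suitable multiple of the generator leaves a lattice vector. Hence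
    \<open>(u1, u2)\<close> and the rows of the Gram matrix together span all integral
    pairs.\<close>
  have gen: "\<exists>j k l. w1 = j * u1 + 2 * \<alpha> * k + \<beta> * l \<and> w2 = j * u2 + \<beta> * k + 2 * \<gamma> * l" for w1 w2
  proof -
    define j where "j = nat (\<phi> (X w1 w2) mod int n)"
    have j: "[int j = \<phi> (X w1 w2)] (mod int n)" using n0 unfolding j_def by simp
    define z where "z = X w1 w2 - real j *\<^sub>R X u1 u2"
    have D: "real j *\<^sub>R X u1 u2 \<in> ?D" using dual_lattice_scale[OF even XD, of "int j"] by simp
    then have zD: "z \<in> ?D" unfolding z_def by (intro dual_lattice_diff[OF even XD])
    have "[\<phi> (X w1 w2) = \<phi> z + \<phi> (real j *\<^sub>R X u1 u2)] (mod int n)"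
      using add[OF zD D] unfolding z_def by simp
    also have "[\<phi> z + \<phi> (real j *\<^sub>R X u1 u2) = \<phi> z + int j * 1] (mod int n)"
      by (intro cong_add cong_refl cong_trans[OF scale[OF XD]] cong_mult u)
    also have "[\<phi> z + int j * 1 = \<phi> z + \<phi> (X w1 w2)] (mod int n)"
      using j by (simp add: cong_add_lcancel)
    finally have "[0 + \<phi> (X w1 w2) = \<phi> z + \<phi> (X w1 w2)] (mod int n)" by simp
    then have "[\<phi> z = 0] (mod int n)" by (simp only: cong_add_rcancel cong_sym_eq)
    then have "z \<in> M" using ker[OF zD] by simp
    then obtain k l where kl: "z = real_of_int k *\<^sub>R e + real_of_int l *\<^sub>R f" unfolding M by blast
    have "C z e = of_int w1 - of_int (int j) * of_int u1" "C z f = of_int w2 - of_int (int j) * of_int u2"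
      unfolding z_def by (simp_all add: lin Xe Xf)
    moreover have "C z e = of_int (2 * \<alpha> * k + \<beta> * l)" "C z f = of_int (\<beta> * k + 2 * \<gamma> * l)"
      unfolding kl by (simp_all add: lin G)
    ultimately have "real_of_int w1 = of_int (int j * u1 + 2 * \<alpha> * k + \<beta> * l)"
      "real_of_int w2 = of_int (int j * u2 + \<beta> * k + 2 * \<gamma> * l)" by simp_all
    then show ?thesis unfolding of_int_eq_iff by blast
  qed
  \<comment> \<open>If \<open>p\<close> divided every Gram entry, the single vector
    \<open>(u1, u2)\<close> would span the plane modulo \<open>p\<close>. The two unit vectors would
    then be proportional modulo \<open>p\<close>, and their determinant gives 1 = 0.\<close>
  have content: "\<not> (int p dvd 2 * \<alpha> \<and> int p dvd \<beta> \<and> int p dvd 2 * \<gamma>)"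
  proof
    assume "int p dvd 2 * \<alpha> \<and> int p dvd \<beta> \<and> int p dvd 2 * \<gamma>"
    then obtain x y z where xyz: "2 * \<alpha> = int p * x" "\<beta> = int p * y" "2 * \<gamma> = int p * z"
      by (auto elim!: dvdE)
    obtain j k l where 1: "1 = j * u1 + 2 * \<alpha> * k + \<beta> * l" "0 = j * u2 + \<beta> * k + 2 * \<gamma> * l"
      using gen[of 1 0] by blast
    obtain j' k' l' where 2: "0 = j' * u1 + 2 * \<alpha> * k' + \<beta> * l'" "1 = j' * u2 + \<beta> * k' + 2 * \<gamma> * l'"
      using gen[of 0 1] by blast
    have m1: "[j * u1 = 1] (mod int p)" "[j' * u2 = 1] (mod int p)"
      and m2: "[j * u2 = 0] (mod int p)" "[j' * u1 = 0] (mod int p)"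
    proof -
      have "j * u1 - 1 = int p * (- (x * k) - y * l)" "j' * u2 - 1 = int p * (- (y * k') - z * l')"
        "j * u2 - 0 = int p * (- (y * k) - z * l)" "j' * u1 - 0 = int p * (- (x * k') - y * l')"
        using 1 2 unfolding xyz by (simp_all add: algebra_simps)
      then show "[j * u1 = 1] (mod int p)" "[j' * u2 = 1] (mod int p)"
        "[j * u2 = 0] (mod int p)" "[j' * u1 = 0] (mod int p)"
        unfolding cong_iff_dvd_diff by (metis dvd_triv_left)+
    qed
    have "[1 * 1 = (j * u1) * (j' * u2)] (mod int p)" by (intro cong_mult cong_sym[OF m1(1)] cong_sym[OF m1(2)])
    also have "(j * u1) * (j' * u2) = (j * u2) * (j' * u1)" by simp
    also have "[(j * u2) * (j' * u1) = 0 * 0] (mod int p)" by (intro cong_mult m2)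
    finally have "int p dvd 1" by (simp add: cong_iff_dvd_diff)
    then show False using p(1) by auto
  qed
  \<comment> \<open>The discriminant module is annihilated by \<open>n\<close>, so \<open>n\<close>
    times the inverse Gram matrix is integral: \<open>d\<close> divides \<open>n\<close> times each
    entry of the adjugate.\<close>
  have exponent: "d dvd int n * (2 * \<gamma> * w1 - \<beta> * w2) \<and> d dvd int n * (2 * \<alpha> * w2 - \<beta> * w1)" for w1 w2
  proof -
    have "[\<phi> (real n *\<^sub>R X w1 w2) = 0] (mod int n)"
      using scale[OF XD, of n w1 w2] by (simp add: cong_def)
    moreover have "real n *\<^sub>R X w1 w2 \<in> ?D" using dual_lattice_scale[OF even XD, of "int n"] by simp
    ultimately have "real n *\<^sub>R X w1 w2 \<in> M" using ker by blast
    then obtain k l where kl: "real n *\<^sub>R X w1 w2 = real_of_int k *\<^sub>R e + real_of_int l *\<^sub>R f"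
      unfolding M by blast
    have "real n * of_int w1 = of_int (2 * \<alpha> * k + \<beta> * l)"
      "real n * of_int w2 = of_int (\<beta> * k + 2 * \<gamma> * l)"
      using arg_cong[OF kl, of "\<lambda>z. C z e"] arg_cong[OF kl, of "\<lambda>z. C z f"]
      by (simp_all add: lin G Xe Xf)
    then have "real_of_int (int n * w1) = of_int (2 * \<alpha> * k + \<beta> * l)"
      "real_of_int (int n * w2) = of_int (\<beta> * k + 2 * \<gamma> * l)" by simp_all
    then have w: "int n * w1 = 2 * \<alpha> * k + \<beta> * l" "int n * w2 = \<beta> * k + 2 * \<gamma> * l"
      by (simp_all only: of_int_eq_iff)
    have "int n * (2 * \<gamma> * w1 - \<beta> * w2) = 2 * \<gamma> * (int n * w1) - \<beta> * (int n * w2)"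
      by (simp add: algebra_simps)
    also have "\<dots> = d * k" unfolding w d_def by (simp add: algebra_simps power2_eq_square)
    finally have 1: "d dvd int n * (2 * \<gamma> * w1 - \<beta> * w2)" by simp
    have "int n * (2 * \<alpha> * w2 - \<beta> * w1) = 2 * \<alpha> * (int n * w2) - \<beta> * (int n * w1)"
      by (simp add: algebra_simps)
    also have "\<dots> = d * l" unfolding w d_def by (simp add: algebra_simps power2_eq_square)
    finally show ?thesis using 1 by simp
  qed
  have dG: "d dvd int n * (2 * \<gamma>)" "d dvd int n * \<beta>" "d dvd int n * (2 * \<alpha>)"
    using exponent[of 1 0] exponent[of 0 1] by simp_all
  \<comment> \<open>Taking determinants, the adjugate has determinant \<open>d\<close>, so
    \<open>d^2\<close> divides \<open>n^2 * d\<close>. Hence \<open>d\<close> is a power of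
    \<open>p\<close> up to sign.\<close>
  have "d * d dvd (int n * (2 * \<gamma>)) * (int n * (2 * \<alpha>)) - (int n * \<beta>) * (int n * \<beta>)"
    by (intro dvd_diff mult_dvd_mono dG)
  also have "\<dots> = d * (int n) ^ 2"
    unfolding d_def by (simp add: algebra_simps power2_eq_square)
  finally have "d dvd (int n) ^ 2" using d0 by simp
  then have "d dvd int p ^ (r * 2)" unfolding n_def by (simp add: power_mult)
  then have "\<exists>j\<le>r * 2. normalize d = normalize (int p ^ j)"
    using divides_primepow_weak[of "int p" d "r * 2"] p(1) by auto
  then obtain j where j: "\<bar>d\<bar> = int p ^ j" by (auto simp: abs_mult)
  \<comment> \<open>By \<open>content\<close> some Gram entry \<open>g\<close> is prime to
    \<open>p\<close> and so to \<open>d\<close>; it can be cancelled from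
    \<open>d dvd n * g\<close>.\<close>
  have dn: "d dvd int n"
  proof -
    obtain g where g: "\<not> int p dvd g" "d dvd int n * g" using content dG by blast
    have "coprime (int p) g" using g(1) p(1) by (simp add: prime_imp_coprime)
    then have "coprime \<bar>d\<bar> g" unfolding j by simp
    then have "coprime d g" by simp
    then show ?thesis using g(2) by (simp add: coprime_dvd_mult_left_iff)
  qed
  \<comment> \<open>\<open>m / d\<close> is the half norm of the generator. Comparing it with
    \<open>a * \<psi>^2 / n\<close>, whose numerator is prime to \<open>n\<close>, shows that
    \<open>n\<close> divides \<open>d\<close>.\<close>
  define m where "m = \<gamma> * u1 ^ 2 + (- \<beta>) * u1 * u2 + \<alpha> * u2 ^ 2"
  obtain z where z: "of_int m / of_int d - of_int a / real n * of_int \<psi> ^ 2 = real_of_int z"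
    using Q[OF XD, of u1 u2] unfolding XQ m_def[symmetric] \<psi>_def[symmetric] by (auto elim: Ints_cases)
  have "real_of_int (int n * m) = of_int d * real n * (of_int m / of_int d)" using rd0 by simp
  also have "\<dots> = of_int d * real n * (of_int z + of_int a / real n * of_int \<psi> ^ 2)"
    using z by (simp add: diff_eq_eq)
  also have "\<dots> = of_int (d * (int n * z + a * \<psi> ^ 2))"
    using n0 by (simp add: algebra_simps)
  finally have nm: "int n * m = d * (int n * z + a * \<psi> ^ 2)" by (simp only: of_int_eq_iff)
  have "[\<psi> = 1] (mod int p)"
    using cong_dvd_modulus[OF u, of "int p"] r unfolding \<psi>_def n_def
    by (simp add: dvd_power odd_pos)
  then have psi: "\<not> int p dvd \<psi>" using p(1) by (auto simp: cong_dvd_iff)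
  have "int n dvd d * (int n * z + a * \<psi> ^ 2)" unfolding nm[symmetric] by simp
  then have "int n dvd d * (a * \<psi> ^ 2)"
    by (metis dvd_add_right_iff dvd_mult dvd_triv_left distrib_left)
  moreover have "\<not> int p dvd a * \<psi> ^ 2"
    using a psi p(1) by (simp add: prime_dvd_mult_iff prime_dvd_power_iff)
  then have "coprime (int n) (a * \<psi> ^ 2)"
    using p(1) unfolding n_def of_nat_power by (intro coprime_power_left_iff[THEN iffD2] disjI1 prime_imp_coprime) auto
  ultimately have nd: "int n dvd d" by (simp add: coprime_dvd_mult_left_iff)
  have "\<bar>d\<bar> = int n" using zdvd_antisym_abs[OF dn nd] by simp
  moreover have n4: "int n mod 4 = 1"
  proof -
    have "[p ^ r = 1 ^ r] (mod 4)" by (rule cong_pow[OF p(2)])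
    then show ?thesis unfolding n_def cong_def using zmod_int[of "p ^ r" 4] by simp
  qed
  \<comment> \<open>As \<beta> is odd, its square is 1 modulo 4. Together with
    \<open>n mod 4 = 1\<close> this rules out \<open>d = n\<close>.\<close>
  moreover have "d mod 4 = 3"
  proof -
    have "odd d" using \<open>\<bar>d\<bar> = int n\<close> op unfolding n_def by (metis dvd_abs_iff even_of_nat even_power)
    then have "odd \<beta>" unfolding d_def by simp
    then obtain t where t: "\<beta> = 2 * t + 1" by (elim oddE)
    have "d = 3 + 4 * (\<alpha> * \<gamma> - t ^ 2 - t - 1)"
      unfolding d_def t by (simp add: algebra_simps power2_eq_square)
    then obtain k where "d = 3 + 4 * k" by blast
    then show ?thesis by presburger
  qed
  ultimately have dneg: "d = - int n" by (cases "d \<ge> 0") auto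
  then have disc: "(- \<beta>) ^ 2 - 4 * \<gamma> * \<alpha> = int p ^ r" unfolding d_def n_def by (simp add: algebra_simps)
  have "int n * m = int n * (- (int n * z) - a * \<psi> ^ 2)" using nm unfolding dneg by (simp add: algebra_simps)
  then have meq: "m = - (int n * z) - a * \<psi> ^ 2" using n0 by simp
  have "int p dvd int n" using r unfolding n_def by (simp add: dvd_power odd_pos)
  \<comment> \<open>The integer \<open>m\<close> is a value of the form with coefficients \<gamma>,
    -\<beta>, \<alpha>, of discriminant \<open>p ^ r\<close>; as -1 is a square modulo
    \<open>p\<close>, it has the same symbol as \<open>a\<close>.\<close>
  then have "[m = (- 1) * a * \<psi> ^ 2] (mod int p)" unfolding meq cong_iff_dvd_diff by simp
  then have "Legendre m (int p) = Legendre ((- 1) * a * \<psi> ^ 2) (int p)" by (rule Legendre_cong)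
  also have "\<dots> = Legendre a (int p)"
    unfolding Legendre_mult[OF p(1) op] Legendre_square[OF psi p(1)]
      Legendre_minus_1[OF p(1) op] using p(2) by simp
  finally have Lm: "Legendre m (int p) = Legendre a (int p)" .
  then have "\<not> int p dvd m"
    using a Legendre_cases[OF a] unfolding Legendre_def by (auto simp: cong_0_iff split: if_splits)
  then have "Legendre m (int p) = 1"
    unfolding m_def by (rule Legendre_of_binary_form[OF p r disc])
  then show ?thesis using Lm by simp
qed

section \<open>The four cases\<close>

lemma coprime_4_odd: "odd (q::nat) \<Longrightarrow> coprime 4 (int q)"
  using coprime_power_left_iff[of "2::int" 2 "int q"] by simp

lemma vector_4:
  "(vector [x, y, z, w] :: 'a::zero ^ 4) $ 1 = x"
  "(vector [x, y, z, w] :: 'a::zero ^ 4) $ 2 = y"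
  "(vector [x, y, z, w] :: 'a::zero ^ 4) $ 3 = z"
  "(vector [x, y, z, w] :: 'a::zero ^ 4) $ 4 = w"
  unfolding vector_def by simp_all

text \<open>The determinant is \<open>p ^ r * (4 * c * m - p ^ r * v^2)\<close>, so
  \<open>unit\<close> makes it \<open>p ^ r\<close> up to sign. In Cramer's rule the factor
  \<open>p ^ r\<close> of the first row cancels for the second coordinate and remains as denominator
  for the first.\<close>

lemma binary_cyclic_discriminant:
  fixes v m c a :: int
  assumes p: "prime p" "odd p" "r > 0" and a: "\<not> int p dvd a"
    and c: "Legendre c (int p) = Legendre a (int p)"
    and A: "A = 2 * of_int c * real p ^ r" "B = real p ^ r * of_int v" "D = 2 * of_int m"
    and unit: "\<bar>int p ^ r * v ^ 2 - 4 * c * m\<bar> = 1"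
  shows "even_lattice std_lattice (gram_form (vector [vector [A, B], vector [B, D]] :: real ^ 2 ^ 2))
    \<and> nondegenerate_lattice std_lattice (gram_form (vector [vector [A, B], vector [B, D]] :: real ^ 2 ^ 2))
    \<and> isometric (discriminant_module std_lattice
        (gram_form (vector [vector [A, B], vector [B, D]] :: real ^ 2 ^ 2))) (cyclic_qm (p ^ r) a)"
proof -
  obtain s where s: "[a * s ^ 2 = c] (mod int p ^ r)" "coprime s (int p ^ r)"
    using same_Legendre_imp_square_multiple[OF p(1-3) a c] .
  let ?G = "vector [vector [A, B], vector [B, D]] :: real ^ 2 ^ 2"
  have G: "?G $ 1 $ 1 = A" "?G $ 1 $ 2 = B" "?G $ 2 $ 1 = B" "?G $ 2 $ 2 = D" by simp_all
  show ?thesis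
  proof (rule cyclic_discriminantI[where k = "1::2" and c = c and s = s])
    show "p ^ r > 0" using p(1) prime_gt_0_nat by simp
    show "?G $ i $ j = ?G $ j $ i" for i j using exhaust_2[of i] exhaust_2[of j] G by auto
    show "?G $ i $ j \<in> \<int>" for i j using exhaust_2[of i] exhaust_2[of j] G A by auto
    have "A = 2 * of_int (c * int p ^ r)" using A by simp
    then show "\<exists>m::int. ?G $ i $ i = 2 * of_int m" for i
      using exhaust_2[of i] G A(3) by metis
    show "?G $ 1 $ 1 = 2 * of_int c * real (p ^ r)" using G A by simp
    show "\<exists>t::int. ?G $ 1 $ j = real (p ^ r) * of_int t" for j
    proof (cases "j = 1")
      case True
      then have "?G $ 1 $ j = real (p ^ r) * of_int (2 * c)" using G A by simp
      then show ?thesis by blast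
    next
      case False
      then have "?G $ 1 $ j = real (p ^ r) * of_int v" using exhaust_2[of j] G A by simp
      then show ?thesis by blast
    qed
    fix x :: "real ^ 2" assume x: "\<And>i. (?G *v x) $ i \<in> \<int>"
    \<comment> \<open>\<delta> is 1 or -1 and thus its own inverse; multiplying by it solves the
      system without separating the two signs.\<close>
    define \<delta> where "\<delta> = int p ^ r * v ^ 2 - 4 * c * m"
    have d2: "\<delta> * \<delta> = 1" using unit unfolding \<delta>_def[symmetric] by (auto simp: abs_if split: if_splits)
    have rd: "real p ^ r * of_int v ^ 2 - 4 * of_int c * of_int m = real_of_int \<delta>"
      unfolding \<delta>_def by simp
    obtain u1 u2 where u: "A * x $ 1 + B * x $ 2 = of_int u1" "B * x $ 1 + D * x $ 2 = of_int u2"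
      using x[of 1] x[of 2] by (auto simp: matrix_vector_mult_def sum_2 elim!: Ints_cases)
    have "of_int (v * u1 - 2 * c * u2) = real_of_int \<delta> * x $ 2"
      unfolding rd[symmetric] of_int_diff of_int_mult u[symmetric] A
      by (simp add: algebra_simps power2_eq_square)
    then have "of_int (\<delta> * (v * u1 - 2 * c * u2)) = real_of_int (\<delta> * \<delta>) * x $ 2" by simp
    then have 2: "x $ 2 = of_int (\<delta> * (v * u1 - 2 * c * u2))" using d2 by simp
    have "of_int (int p ^ r * v * u2 - 2 * m * u1) = real_of_int \<delta> * (real p ^ r * x $ 1)"
      unfolding rd[symmetric] of_int_diff of_int_mult u[symmetric] A
      by (simp add: algebra_simps power2_eq_square)
    then have "of_int (\<delta> * (int p ^ r * v * u2 - 2 * m * u1))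
      = real_of_int (\<delta> * \<delta>) * (real p ^ r * x $ 1)" by simp
    then have 1: "real p ^ r * x $ 1 = of_int (\<delta> * (int p ^ r * v * u2 - 2 * m * u1))"
      using d2 by simp
    have "real (p ^ r) * x $ 1 \<in> \<int>" unfolding of_nat_power 1 by (rule Ints_of_int)
    moreover have "x $ 2 \<in> \<int>" unfolding 2 by (rule Ints_of_int)
    ultimately show "real (p ^ r) * x $ 1 \<in> \<int> \<and> (\<forall>i. i \<noteq> 1 \<longrightarrow> x $ i \<in> \<int>)"
      by (simp add: forall_2)
  qed (use s in simp_all)
qed

text \<open>The lower right block is the Gram matrix of the root lattice A2, of determinant 3.
  Expanding, the whole determinant is \<open>p ^ r\<close> times the left side of
  \<open>unit\<close>, hence \<open>p ^ r\<close>.\<close>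

lemma quaternary_cyclic_discriminant:
  fixes v m c a :: int
  assumes p: "prime p" "odd p" "r > 0" and a: "\<not> int p dvd a"
    and c: "Legendre c (int p) = Legendre a (int p)"
    and A: "A = 2 * of_int c * real p ^ r" "B = real p ^ r * of_int v" "D = 2 * of_int m"
    and unit: "12 * c * m - 4 * c - 3 * (int p ^ r * v ^ 2) = 1"
    and G_def: "G = (vector [vector [A, B, 0, 0], vector [B, D, 1, 0], vector [0, 1, 2, 1],
      vector [0, 0, 1, 2]] :: real ^ 4 ^ 4)"
  shows "even_lattice std_lattice (gram_form G) \<and> nondegenerate_lattice std_lattice (gram_form G)
    \<and> isometric (discriminant_module std_lattice (gram_form G)) (cyclic_qm (p ^ r) a)"
proof -
  obtain s where s: "[a * s ^ 2 = c] (mod int p ^ r)" "coprime s (int p ^ r)"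
    using same_Legendre_imp_square_multiple[OF p(1-3) a c] .
  have G: "G $ 1 $ 1 = A" "G $ 1 $ 2 = B" "G $ 1 $ 3 = 0" "G $ 1 $ 4 = 0"
    "G $ 2 $ 1 = B" "G $ 2 $ 2 = D" "G $ 2 $ 3 = 1" "G $ 2 $ 4 = 0"
    "G $ 3 $ 1 = 0" "G $ 3 $ 2 = 1" "G $ 3 $ 3 = 2" "G $ 3 $ 4 = 1"
    "G $ 4 $ 1 = 0" "G $ 4 $ 2 = 0" "G $ 4 $ 3 = 1" "G $ 4 $ 4 = 2"
    unfolding G_def vector_4 by (rule refl)+
  show ?thesis
  proof (rule cyclic_discriminantI[where k = "1::4" and c = c and s = s])
    show "p ^ r > 0" using p(1) prime_gt_0_nat by simp
    have "\<forall>i j. G $ i $ j = G $ j $ i" unfolding forall_4 G by simp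
    then show "G $ i $ j = G $ j $ i" for i j by blast
    have "\<forall>i j. G $ i $ j \<in> \<int>" unfolding forall_4 G using A by simp
    then show "G $ i $ j \<in> \<int>" for i j by blast
    have "A = 2 * of_int (c * int p ^ r)" "(2::real) = 2 * of_int 1" using A by simp_all
    then have "\<forall>i. \<exists>m::int. G $ i $ i = 2 * of_int m" unfolding forall_4 G using A(3) by blast
    then show "\<exists>m::int. G $ i $ i = 2 * of_int m" for i by blast
    show "G $ 1 $ 1 = 2 * of_int c * real (p ^ r)" using G A by simp
    have "A = real (p ^ r) * of_int (2 * c)" "B = real (p ^ r) * of_int v"
      "0 = real (p ^ r) * of_int 0" using A by simp_all
    then have "\<forall>j. \<exists>t::int. G $ 1 $ j = real (p ^ r) * of_int t" unfolding forall_4 G by blast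
    then show "\<exists>t::int. G $ 1 $ j = real (p ^ r) * of_int t" for j by blast
    fix x :: "real ^ 4" assume x: "\<And>i. (G *v x) $ i \<in> \<int>"
    obtain u1 u2 u3 u4 where u: "A * x $ 1 + B * x $ 2 = of_int u1"
      "B * x $ 1 + D * x $ 2 + x $ 3 = of_int u2"
      "x $ 2 + 2 * x $ 3 + x $ 4 = of_int u3" "x $ 3 + 2 * x $ 4 = of_int u4"
      using x[of 1] x[of 2] x[of 3] x[of 4]
      by (auto simp: matrix_vector_mult_def sum_4 G elim!: Ints_cases)
    have unit': "12 * of_int c * of_int m - 4 * of_int c - 3 * (real p ^ r * of_int v ^ 2) = 1"
      using arg_cong[OF unit, of real_of_int] by simp
    \<comment> \<open>The combination \<open>3 * u2 - 2 * u3 + u4\<close> eliminates the third and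
      fourth coordinates; what remains is a binary system solved by Cramer's rule.\<close>
    have "of_int (2 * c * (3 * u2 - 2 * u3 + u4) - 3 * v * u1)
      = (12 * of_int c * of_int m - 4 * of_int c - 3 * (real p ^ r * of_int v ^ 2)) * x $ 2"
      unfolding of_int_diff of_int_mult of_int_add u[symmetric] A
      by (simp add: algebra_simps power2_eq_square)
    then have 2: "x $ 2 = of_int (2 * c * (3 * u2 - 2 * u3 + u4) - 3 * v * u1)"
      unfolding unit' by simp
    have "of_int ((6 * m - 2) * u1 - int p ^ r * v * (3 * u2 - 2 * u3 + u4))
      = (12 * of_int c * of_int m - 4 * of_int c - 3 * (real p ^ r * of_int v ^ 2)) * (real p ^ r * x $ 1)"
      unfolding of_int_diff of_int_mult of_int_add u[symmetric] A
      by (simp add: algebra_simps power2_eq_square)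
    then have 1: "real p ^ r * x $ 1 = of_int ((6 * m - 2) * u1 - int p ^ r * v * (3 * u2 - 2 * u3 + u4))"
      unfolding unit' by simp
    have i1: "real p ^ r * x $ 1 \<in> \<int>" unfolding 1 by (rule Ints_of_int)
    have i2: "x $ 2 \<in> \<int>" unfolding 2 by (rule Ints_of_int)
    \<comment> \<open>Back substitution in the second and third rows gives the remaining
      coordinates.\<close>
    have "x $ 3 = of_int u2 - of_int v * (real p ^ r * x $ 1) - of_int (2 * m) * x $ 2"
      using u(2) unfolding A by (simp add: algebra_simps)
    then have i3: "x $ 3 \<in> \<int>" using i1 i2 by (metis Ints_diff Ints_mult Ints_of_int)
    have "x $ 4 = of_int u3 - x $ 2 - of_int 2 * x $ 3" using u(3) by simp
    then have i4: "x $ 4 \<in> \<int>" using i2 i3 by (metis Ints_diff Ints_mult Ints_of_int)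
    show "real (p ^ r) * x $ 1 \<in> \<int> \<and> (\<forall>i. i \<noteq> 1 \<longrightarrow> x $ i \<in> \<int>)"
      using i1 i2 i3 i4 by (simp add: forall_4)
  qed (use s in simp_all)
qed

text \<open>The upper left entry is \<open>2 * c * p ^ r\<close> with \<open>c\<close> equal to 1,
  \<open>q\<close>, -1 and \<open>q\<close> in the four cases, each with the Legendre symbol of
  \<open>a\<close>. The type \<open>'v\<close> in the nonexistence claims is arbitrary, so they
  cover lattices in every real vector space.\<close>

theorem theorem4p2:
  fixes p r :: nat and a :: int
  assumes "prime p" and "odd p" and "r > 0" and "coprime (int p) a"
  shows
    "(Legendre a (int p) = 1 \<longrightarrow>
       (let L = (std_lattice :: (real ^ 2) set);
            B = gram_form (vector
                  [vector [2 * real p ^ r, real p ^ r],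
                   vector [real p ^ r, (real p ^ r - of_int (Legendre (- 1) (int p)) ^ r) / 2]])
        in even_lattice L B \<and> nondegenerate_lattice L B
           \<and> isometric (discriminant_module L B) (cyclic_qm (p ^ r) a)
           \<and> \<not> (\<exists>(M :: 'v::real_vector set) C. even_lattice M C \<and> nondegenerate_lattice M C
                  \<and> lattice_rank M < lattice_rank L
                  \<and> isometric (discriminant_module M C) (cyclic_qm (p ^ r) a))))
   \<and> (Legendre a (int p) = - 1 \<and> even r \<longrightarrow>
       (\<forall>(q::nat) (v::int). prime q \<and> odd q \<and> q \<noteq> p \<and> Legendre (int q) (int p) = - 1
          \<and> [int p ^ r * v ^ 2 = 1] (mod int q) \<and> [v ^ 2 = 1] (mod 4) \<longrightarrow>
       (let L = (std_lattice :: (real ^ 2) set);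
            B = gram_form (vector
                  [vector [2 * real q * real p ^ r, real p ^ r * of_int v],
                   vector [real p ^ r * of_int v, (real p ^ r * of_int v ^ 2 - 1) / (2 * real q)]])
        in even_lattice L B \<and> nondegenerate_lattice L B
           \<and> isometric (discriminant_module L B) (cyclic_qm (p ^ r) a)
           \<and> \<not> (\<exists>(M :: 'v::real_vector set) C. even_lattice M C \<and> nondegenerate_lattice M C
                  \<and> lattice_rank M < lattice_rank L
                  \<and> isometric (discriminant_module M C) (cyclic_qm (p ^ r) a)))))
   \<and> (Legendre a (int p) = - 1 \<and> odd r \<and> [p = 3] (mod 4) \<longrightarrow>
       (let L = (std_lattice :: (real ^ 2) set);
            B = gram_form (vector
                  [vector [- 2 * real p ^ r, real p ^ r],
                   vector [real p ^ r, - (real p ^ r + 1) / 2]])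
        in even_lattice L B \<and> nondegenerate_lattice L B
           \<and> isometric (discriminant_module L B) (cyclic_qm (p ^ r) a)
           \<and> \<not> (\<exists>(M :: 'v::real_vector set) C. even_lattice M C \<and> nondegenerate_lattice M C
                  \<and> lattice_rank M < lattice_rank L
                  \<and> isometric (discriminant_module M C) (cyclic_qm (p ^ r) a))))
   \<and> (Legendre a (int p) = - 1 \<and> odd r \<and> [p = 1] (mod 4) \<longrightarrow>
       \<not> (\<exists>(M :: 'v::real_vector set) C. even_lattice M C \<and> nondegenerate_lattice M C
             \<and> lattice_rank M \<in> {1, 2}
             \<and> isometric (discriminant_module M C) (cyclic_qm (p ^ r) a))
     \<and> (\<forall>(q::nat) (v::int) (x::real). prime q \<and> odd q \<and> [q = 2] (mod 3)
          \<and> Legendre (int q) (int p) = - 1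
          \<and> [int p ^ r * v ^ 2 = - ((4 * int q + 1) div 3)] (mod int q)
          \<and> [v ^ 2 = - ((4 * int q + 1) div 3)] (mod 4)
          \<and> x = 1 / (4 * real q) * (real p ^ r * of_int v ^ 2 + (4 * real q + 1) / 3) \<longrightarrow>
       (let L = (std_lattice :: (real ^ 4) set);
            B = gram_form (vector
                  [vector [2 * real q * real p ^ r, real p ^ r * of_int v, 0, 0],
                   vector [real p ^ r * of_int v, 2 * x, 1, 0],
                   vector [0, 1, 2, 1],
                   vector [0, 0, 1, 2]])
        in even_lattice L B \<and> nondegenerate_lattice L B \<and> lattice_rank L = 4
           \<and> isometric (discriminant_module L B) (cyclic_qm (p ^ r) a))))"
proof -
  have a: "\<not> int p dvd a"
    using assms(1,4) by (metis coprime_common_divisor dvd_refl not_prime_unit prime_nat_int_transfer)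
  have n: "odd (p ^ r)" "p ^ r > 1"
    using assms(2) one_less_power[OF prime_gt_1_nat[OF assms(1)] assms(3)] by simp_all
  have small: "\<not> (\<exists>(M :: 'v set) C. even_lattice M C \<and> nondegenerate_lattice M C
      \<and> lattice_rank M < lattice_rank (std_lattice :: (real ^ 2) set)
      \<and> isometric (discriminant_module M C) (cyclic_qm (p ^ r) a))"
    unfolding lattice_rank_std using lattice_rank_ge_2[OF _ n, where a = a] by force
  have p4: "p mod 4 = 1 \<or> p mod 4 = 3" using assms(2) by presburger
  have L1: "Legendre 1 (int p) = 1"
    using Legendre_square[of p 1] assms(1) not_prime_1 by fastforce
  note bin = binary_cyclic_discriminant[OF assms(1-3) a]
  show ?thesis
  proof (intro conjI impI, goal_cases)
    case 1
    \<comment> \<open>Since \<open>p\<close> is congruent to its symbol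
      \<open>Legendre (- 1) p\<close> modulo 4, the lower right entry is even. With
      \<open>c = v = 1\<close> the unit condition reads
      \<open>p ^ r - 4 * m = \<epsilon>\<close>.\<close>
    define \<epsilon> where "\<epsilon> = Legendre (- 1) (int p) ^ r"
    have "4 dvd int p ^ r - \<epsilon>"
    proof -
      have "[int p = Legendre (- 1) (int p)] (mod 4)"
        unfolding Legendre_minus_1[OF assms(1,2)] using p4
        by (auto simp: cong_def zmod_int[symmetric]) presburger+
      then have "[int p ^ r = \<epsilon>] (mod 4)" unfolding \<epsilon>_def by (rule cong_pow)
      then show ?thesis by (simp add: cong_iff_dvd_diff)
    qed
    then obtain m where m: "int p ^ r - \<epsilon> = 4 * m" by (elim dvdE)
    have eps: "\<bar>\<epsilon>\<bar> = 1"
      unfolding \<epsilon>_def Legendre_minus_1[OF assms(1,2)] by (simp add: power_abs)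
    have "(real p ^ r - of_int (Legendre (- 1) (int p)) ^ r) / 2 = 2 * of_int m"
      using arg_cong[OF m, of real_of_int] unfolding \<epsilon>_def by simp
    then show ?case
      using bin[of 1 "2 * real p ^ r" "real p ^ r" 1 _ m] m eps L1 1 small by (simp add: Let_def)
  next
    case 2
    show ?case
    proof (intro allI impI)
      fix q :: nat and v :: int
      assume q: "prime q \<and> odd q \<and> q \<noteq> p \<and> Legendre (int q) (int p) = - 1
        \<and> [int p ^ r * v ^ 2 = 1] (mod int q) \<and> [v ^ 2 = 1] (mod 4)"
      \<comment> \<open>For even \<open>r\<close> this makes \<open>p ^ r * v^2\<close> congruent to
        1 modulo 4 as well as modulo \<open>q\<close>, hence modulo \<open>4 * q\<close>; the
        quotient \<open>m\<close> is half the lower right entry.\<close>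
      have "[int p ^ r = 1] (mod 4)"
      proof -
        obtain k where k: "r = 2 * k" using 2 by (auto elim: evenE)
        have "[int p ^ 2 = 1] (mod 4)"
        proof -
          obtain t where "int p = 2 * t + 1" using assms(2) by (metis even_of_nat oddE)
          then have "int p ^ 2 - 1 = 4 * (t ^ 2 + t)" by (simp add: power2_eq_square algebra_simps)
          then show ?thesis by (simp add: cong_iff_dvd_diff)
        qed
        then show ?thesis using cong_pow[of "int p ^ 2" 1 4 k] unfolding k power_mult by simp
      qed
      then have "[int p ^ r * v ^ 2 = 1 * 1] (mod 4)" using q by (intro cong_mult) auto
      then have "4 * int q dvd int p ^ r * v ^ 2 - 1"
        using q by (intro divides_mult) (use coprime_4_odd[of q] in \<open>auto simp: cong_iff_dvd_diff\<close>)
      then obtain m where m: "int p ^ r * v ^ 2 - 1 = 4 * int q * m" by (elim dvdE)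
      have q0: "q > 0" using q prime_gt_0_nat by blast
      have "real p ^ r * of_int v ^ 2 - 1 = 4 * real q * of_int m"
        using arg_cong[OF m, of real_of_int] by simp
      then have "(real p ^ r * of_int v ^ 2 - 1) / (2 * real q) = 2 * of_int m"
        using q0 by (simp add: field_simps)
      then show "let L = (std_lattice :: (real ^ 2) set);
            B = gram_form (vector
                  [vector [2 * real q * real p ^ r, real p ^ r * of_int v],
                   vector [real p ^ r * of_int v, (real p ^ r * of_int v ^ 2 - 1) / (2 * real q)]])
        in even_lattice L B \<and> nondegenerate_lattice L B
           \<and> isometric (discriminant_module L B) (cyclic_qm (p ^ r) a)
           \<and> \<not> (\<exists>(M :: 'v set) C. even_lattice M C \<and> nondegenerate_lattice M C
                  \<and> lattice_rank M < lattice_rank L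
                  \<and> isometric (discriminant_module M C) (cyclic_qm (p ^ r) a))"
        using bin[of "int q" "2 * real q * real p ^ r" "real p ^ r * of_int v" v _ m] m q 2 small
        by (simp add: Let_def)
    qed
  next
    case 3
    \<comment> \<open>Here \<open>c = - 1\<close>, a nonresidue like \<open>a\<close>. As
      \<open>r\<close> is odd, \<open>p ^ r + 1 = 4 * k\<close>, and \<open>m = - k\<close> turns
      the unit condition into \<open>p ^ r - 4 * k = - 1\<close>.\<close>
    have "[p ^ r = 3] (mod 4)"
    proof -
      obtain k where k: "r = Suc (2 * k)" using 3 by (metis oddE Suc_eq_plus1)
      have "[p ^ 2 = 3 ^ 2] (mod 4)" using 3 by (intro cong_pow) auto
      then have "[p ^ 2 = 1] (mod 4)" by (simp add: cong_def)
      then have "[p * (p ^ 2) ^ k = 3 * 1 ^ k] (mod 4)" using 3 by (intro cong_mult cong_pow) auto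
      then show ?thesis unfolding k by (simp add: power_mult)
    qed
    then have "4 dvd p ^ r + 1" unfolding cong_def by presburger
    then obtain k where k: "p ^ r + 1 = 4 * k" by (elim dvdE)
    have kr: "real p ^ r + 1 = 4 * real k" and ki: "int p ^ r + 1 = 4 * int k"
      using arg_cong[OF k, of real] arg_cong[OF k, of int] by simp_all
    have "Legendre (- 1) (int p) = Legendre a (int p)"
      using 3 Legendre_minus_1[OF assms(1,2)] by (simp add: cong_def)
    moreover have "- (real p ^ r + 1) / 2 = 2 * of_int (- int k)" unfolding kr by simp
    ultimately show ?case
      using bin[of "- 1" "- 2 * real p ^ r" "real p ^ r" 1 _ "- int k"] ki small by (simp add: Let_def)
  next
    case 4
    have "lattice_rank M \<noteq> 2" if "even_lattice M C" "nondegenerate_lattice M C"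
      "isometric (discriminant_module M C) (cyclic_qm (p ^ r) a)" for M :: "'v set" and C
      using rank_2_discriminant_imp_Legendre[OF assms(1) _ _ a that(1,2) _ that(3)] 4 by auto
    moreover have "lattice_rank M \<noteq> 1" if "even_lattice M C"
      "isometric (discriminant_module M C) (cyclic_qm (p ^ r) a)" for M :: "'v set" and C
      using lattice_rank_ge_2[OF that(1) n that(2)] by simp
    ultimately show ?case by blast
  next
    case 5
    show ?case
    proof (intro allI impI)
      fix q :: nat and v :: int and x :: real
      assume q: "prime q \<and> odd q \<and> [q = 2] (mod 3) \<and> Legendre (int q) (int p) = - 1
          \<and> [int p ^ r * v ^ 2 = - ((4 * int q + 1) div 3)] (mod int q)
          \<and> [v ^ 2 = - ((4 * int q + 1) div 3)] (mod 4)
          \<and> x = 1 / (4 * real q) * (real p ^ r * of_int v ^ 2 + (4 * real q + 1) / 3)"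
      \<comment> \<open>The division is exact because \<open>q\<close> is 2 modulo 3. This
        \<open>c\<close> only enters the congruences for \<open>v\<close>; the coefficient in the
        upper left entry is \<open>q\<close>.\<close>
      define c where "c = (4 * int q + 1) div 3"
      have "[q = 2] (mod 3)" using q by blast
      then have "3 dvd 4 * q + 1" unfolding cong_def by presburger
      then have "3 dvd 4 * int q + 1" by presburger
      then have c: "3 * c = 4 * int q + 1" unfolding c_def by simp
      have "[int p = 1] (mod 4)" using 5 cong_int_iff[of p 1 4] by simp
      then have "[int p ^ r = 1] (mod 4)" using cong_pow[of "int p" 1 4 r] by simp
      then have "[int p ^ r * v ^ 2 = 1 * (- c)] (mod 4)" using q unfolding c_def by (intro cong_mult) auto
      then have "4 * int q dvd int p ^ r * v ^ 2 - (- c)"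
        using q unfolding c_def[symmetric]
        by (intro divides_mult) (use coprime_4_odd[of q] in \<open>auto simp: cong_iff_dvd_diff\<close>)
      then obtain m where m: "int p ^ r * v ^ 2 + c = 4 * int q * m" by (auto elim: dvdE)
      have q0: "q > 0" using q prime_gt_0_nat by blast
      have "real p ^ r * of_int v ^ 2 + of_int c = 4 * real q * of_int m"
        using arg_cong[OF m, of real_of_int] by simp
      moreover have "(4 * real q + 1) / 3 = of_int c" using arg_cong[OF c, of real_of_int] by simp
      ultimately have x: "x = of_int m" using q q0 by simp
      \<comment> \<open>Three times the equation defining \<open>m\<close>, combined with
        \<open>3 * c = 4 * q + 1\<close>.\<close>
      have unit: "12 * int q * m - 4 * int q - 3 * (int p ^ r * v ^ 2) = 1" using m c by simp
      show "let L = (std_lattice :: (real ^ 4) set);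
            B = gram_form (vector
                  [vector [2 * real q * real p ^ r, real p ^ r * of_int v, 0, 0],
                   vector [real p ^ r * of_int v, 2 * x, 1, 0],
                   vector [0, 1, 2, 1],
                   vector [0, 0, 1, 2]])
        in even_lattice L B \<and> nondegenerate_lattice L B \<and> lattice_rank L = 4
           \<and> isometric (discriminant_module L B) (cyclic_qm (p ^ r) a)"
        using quaternary_cyclic_discriminant[OF assms(1-3) a _ _ refl _ unit refl,
            of "2 * real q * real p ^ r" "2 * x"] q x 5
        by (simp add: Let_def lattice_rank_std)
    qed
  qed
qed

end
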